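(* Let $\widehat{\Sigma}$ be an operator precedence alphabet with underlying finite alphabet $\Sigma$. For every operator precedence language $L\subseteq\Sigma^*$ over $\widehat{\Sigma}$, the syntactic congruence $\equiv_L$ is a language abstraction of $L$.
   Context: **Operator precedence alphabet.** $\widehat{\Sigma}$ is a finite alphabet $\Sigma$ together with three relations $\lessdot,\gtrdot,\doteq$ on $\Sigma$ such that for every ordered pair $(a,b)\in\Sigma^2$ exactly one of $a\lessdot b$, $a\gtrdot b$, $a\doteq b$ holds (no reflexivity, symmetry or transitivity is assumed). The relations are extended to the empty word $\varepsilon$ by $\varepsilon\lessdot a$, $a\gtrdot\varepsilon$ for all $a\in\Sigma$, and $\varepsilon\doteq\varepsilon$. For $w\in\Sigma^*$, $\mathrm{first}(w)$ and $\mathrm{last}(w)$ are its first and last letters, with $\mathrm{first}(\varepsilon)=\mathrm{last}(\varepsilon)=\varepsilon$. **Chains.** Chains with delimiters $a_0,a_{n+1}\in\Sigma\cup\{\varepsilon\}$ and body in $\Sigma^+$ are defined inductively. For $n\ge 1$ and $a_1,\dots,a_n\in\Sigma$ with $a_0\lessdot a_1\doteq a_2\doteq\cdots\doteq a_n\gtrdot a_{n+1}$, the word $a_0a_1\cdots a_na_{n+1}$ is a (simple) chain with delimiters $a_0,a_{n+1}$ and body $a_1\cdots a_n$. If moreover $u_0,\dots,u_n\in\Sigma^*$ are such that for each $0\le i\le n$ either $u_i=\varepsilon$ or $a_iu_ia_{i+1}$ is a chain with delimiters $a_i,a_{i+1}$ and body $u_i$, then $a_0u_0a_1u_1\cdots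 a_nu_na_{n+1}$ is a (composite) chain with delimiters $a_0,a_{n+1}$ and body $u_0a_1u_1\cdots a_nu_n$. For $x,y,z\in\Sigma^*$, write ${}^x[y]^z$ if $\mathrm{last}(x)\,y\,\mathrm{first}(z)$ is a chain with delimiters $\mathrm{last}(x),\mathrm{first}(z)$ and body $y$. **Collapsing.** $\lambda:\Sigma^*\to\Sigma^*$ is defined by $\lambda(w)=\lambda(xz)$ if $w=xyz$ with $x,y,z\in\Sigma^+$ and ${}^x[y]^z$, and $\lambda(w)=w$ if there is no such factorization (the result does not depend on the choices). Let $\Sigma^*_{\unlhd}$ (resp. $\Sigma^*_{\unrhd}$) be the set of $w\in\Sigma^*$ such that $|\lambda(w)|\le 1$ or $\lambda(w)=a_1\cdots a_n$ with, for every $1\le i<n$, $a_i\lessdot a_{i+1}$ or $a_i\doteq a_{i+1}$ (resp. $a_i\gtrdot a_{i+1}$ or $a_i\doteq a_{i+1}$). **Chain equivalence.** For $x,y\in\Sigma^*$, $x\approx y$ iff $\mathrm{first}(x)=\mathrm{first}(y)$, $\mathrm{last}(x)=\mathrm{last}(y)$, and for all $u,v,u_0,v_0\in\Sigma^*$ with $u_0\,\mathrm{first}(x)\in\Sigma^*_{\unrhd}$ and $\mathrm{last}(x)\,v_0\in\Sigma^*_{\unlhd}$: ${}^u[u_0xv_0]^v\Leftrightarrow{}^u[u_0yv_0]^v$. **Syntactic congruence.** For $L\subseteq\Sigma^*$, $x\equiv_L y$ iff $x\approx y$ and for all $u,v,u_0,v_0\in\Sigma^*$ with $u_0\,\mathrm{first}(x)\in\Sigma^*_{\unrhd}$,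 $\mathrm{last}(x)\,v_0\in\Sigma^*_{\unlhd}$ and ${}^u[u_0xv_0]^v$: $uu_0xv_0v\in L\Leftrightarrow uu_0yv_0v\in L$. **Chain-monotonicity.** A relation $R$ on $\Sigma^*$ is chain-monotonic if $x\,R\,y$ implies $uu_0xv_0v\;R\;uu_0yv_0v$ for all $x,y,u,v,u_0,v_0\in\Sigma^*$ such that, for each $z\in\{x,y\}$, $u_0\,\mathrm{first}(z)\in\Sigma^*_{\unrhd}$, $\mathrm{last}(z)\,v_0\in\Sigma^*_{\unlhd}$ and ${}^u[u_0zv_0]^v$. **Language abstraction.** A quasi-order (reflexive transitive relation) $\preccurlyeq$ on $\Sigma^*$ is a language abstraction of $L\subseteq\Sigma^*$ iff (1) it is decidable, i.e. whether $x\preccurlyeq y$ holds is computable from $x,y$; (2) it is chain-monotonic; (3) it is a well quasi-order, i.e. for every $Y\subseteq\Sigma^*$ there is a finite $X\subseteq Y$ such that every $y\in Y$ satisfies $x\preccurlyeq y$ for some $x\in X$; (4) it saturates $L$: $w_0\preccurlyeq w$ and $w_0\in L$ imply $w\in L$. **Operator precedence automata and languages.** An operator precedence automaton (OPA) over $\widehat{\Sigma}$ consists of a finite set of states $Q$, initial states $I\subseteq Q$, accepting states $F\subseteq Q$, and transition relations $\Delta_{\mathrm{push}},\Delta_{\mathrm{shift}}\subseteq Q\times\Sigma\times Q$, $\Delta_{\mathrm{pop}}\subseteq Q\times Q\times Q$. The stack alphabet is $\Gamma=\Sigma\times Q$; $\bot$ is the empty stack; the top is on the left. A configuration is $(s,w,\theta)$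 with $s\in Q$, remaining input $w\in\Sigma^*$, and stack $\theta$. Let $a=\mathrm{first}(w)$. Steps are: - push: if $w=aw'$ with $a\in\Sigma$, and $\theta=\bot$ or the top of $\theta$ is $\langle a',q\rangle$ with $a'\lessdot a$, and $(s,a,t)\in\Delta_{\mathrm{push}}$, then $(s,w,\theta)\to(t,w',\langle a,s\rangle\theta)$; - shift: if $w=aw'$ with $a\in\Sigma$, $\theta=\langle a',q\rangle\theta'$, $a'\doteq a$, and $(s,a,t)\in\Delta_{\mathrm{shift}}$, then $(s,w,\theta)\to(t,w',\langle a,q\rangle\theta')$; - pop: if $\theta=\langle a',q\rangle\theta'$, $a'\gtrdot a$ (where $a=\varepsilon$ is allowed when $w=\varepsilon$), and $(s,q,t)\in\Delta_{\mathrm{pop}}$, then $(s,w,\theta)\to(t,w,\theta')$. The language of the OPA is the set of $w\in\Sigma^*$ such that $(q_0,w,\bot)\to^*(q_F,\varepsilon,\bot)$ for some $q_0\in I$, $q_F\in F$. An operator precedence language over $\widehat{\Sigma}$ is a language recognized by some OPA over $\widehat{\Sigma}$. *)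

theory Defs
  imports Main "HOL-Library.Countable" "HOL-Library.Nat_Bijection"
begin

section \<open>Operator precedence alphabets\<close>

text \<open>
  The alphabet is a finite type. Three relations such that exactly one of them holds for each
  ordered pair of letters are the same as a function into a three-element type (the operator
  precedence matrix). \<open>Lt\<close>, \<open>Eq\<close> and \<open>Gt\<close> stand for \<open>\<lessdot>\<close>, \<open>\<doteq>\<close> and \<open>\<gtrdot>\<close>;
  none of them is assumed to be reflexive, symmetric or transitive.
\<close>

datatype prec = Lt | Eq | Gt

type_synonym 'a opm = "'a \<Rightarrow> 'a \<Rightarrow> prec"

text \<open>An element of \<open>\<Sigma> \<union> {\<epsilon>}\<close> is an \<open>'a option\<close>, with \<open>None\<close> for \<open>\<epsilon>\<close>.\<close>

fun eprec :: "'a opm \<Rightarrow> 'a option \<Rightarrow> 'a option \<Rightarrow> prec" where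
  "eprec M (Some a) (Some b) = M a b"
| "eprec M None (Some b) = Lt"
| "eprec M (Some a) None = Gt"
| "eprec M None None = Eq"

definition first :: "'a list \<Rightarrow> 'a option" where
  "first w = (if w = [] then None else Some (hd w))"

definition final :: "'a list \<Rightarrow> 'a option" where
  "final w = (if w = [] then None else Some (last w))"

fun word :: "'a option \<Rightarrow> 'a list" where
  "word None = []"
| "word (Some a) = [a]"


section \<open>Chains\<close>

definition skeleton :: "'a opm \<Rightarrow> 'a option \<Rightarrow> 'a list \<Rightarrow> 'a option \<Rightarrow> bool" where
  "skeleton M l as r \<longleftrightarrow>
     as \<noteq> [] \<and>
     eprec M l (Some (hd as)) = Lt \<and>
     (\<forall>i. Suc i < length as \<longrightarrow> M (as ! i) (as ! Suc i) = Eq) \<and>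
     eprec M (Some (last as)) r = Gt"

text \<open>
  \<open>chain M l y r\<close>: the word \<open>l y r\<close> is a chain with delimiters \<open>l\<close>, \<open>r\<close> and body \<open>y\<close>.
  In the composite case \<open>us\<close> lists \<open>u\<^sub>0, \<dots>, u\<^sub>n\<close> and \<open>l # map Some as @ [r]\<close> lists
  \<open>a\<^sub>0, \<dots>, a\<^sub>n\<^sub>+\<^sub>1\<close>.
\<close>

inductive chain :: "'a opm \<Rightarrow> 'a option \<Rightarrow> 'a list \<Rightarrow> 'a option \<Rightarrow> bool"
  for M :: "'a opm" where
  simple: "skeleton M l as r \<Longrightarrow> chain M l as r"
| composite: "\<lbrakk> skeleton M l as r; length us = Suc (length as);
     \<forall>i < length us. us ! i = [] \<or>
       chain M ((l # map Some as @ [r]) ! i) (us ! i) ((l # map Some as @ [r]) ! Suc i) \<rbrakk>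
   \<Longrightarrow> chain M l (hd us @ concat (map2 (#) as (tl us))) r"

definition chain_in :: "'a opm \<Rightarrow> 'a list \<Rightarrow> 'a list \<Rightarrow> 'a list \<Rightarrow> bool" where
  "chain_in M x y z \<longleftrightarrow> chain M (final x) y (first z)"


section \<open>Collapsing\<close>

inductive collapse_step :: "'a opm \<Rightarrow> 'a list \<Rightarrow> 'a list \<Rightarrow> bool"
  for M :: "'a opm" where
  "\<lbrakk> x \<noteq> []; y \<noteq> []; z \<noteq> []; chain_in M x y z \<rbrakk> \<Longrightarrow> collapse_step M (x @ y @ z) (x @ z)"

text \<open>
  Collapsing shortens the word, so a normal form exists; as chains cannot overlap properly,
  it is unique and the choice operator is harmless.
\<close>

definition collapse :: "'a opm \<Rightarrow> 'a list \<Rightarrow> 'a list" where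
  "collapse M w = (SOME v. (collapse_step M)\<^sup>*\<^sup>* w v \<and> (\<nexists>v'. collapse_step M v v'))"

lemma collapse_normal_form:
  "(collapse_step M)\<^sup>*\<^sup>* w (collapse M w)" "\<nexists>v'. collapse_step M (collapse M w) v'"
proof -
  have "\<exists>v. (collapse_step M)\<^sup>*\<^sup>* w v \<and> (\<nexists>v'. collapse_step M v v')"
  proof (induction w rule: length_induct)
    case (1 w)
    show ?case
    proof (cases "\<exists>w'. collapse_step M w w'")
      case True
      then obtain w' where w': "collapse_step M w w'" by blast
      then have "length w' < length w" by (auto elim!: collapse_step.cases)
      with 1 w' show ?thesis by (meson converse_rtranclp_into_rtranclp)
    qed blast
  qed
  from someI_ex[OF this]
  show "(collapse_step M)\<^sup>*\<^sup>* w (collapse M w)" "\<nexists>v'. collapse_step M (collapse M w) v'"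
    unfolding collapse_def by blast+
qed

definition lt_eq_words :: "'a opm \<Rightarrow> 'a list set" where
  "lt_eq_words M = {w. length (collapse M w) \<le> 1 \<or>
     (\<forall>i. Suc i < length (collapse M w) \<longrightarrow>
       M (collapse M w ! i) (collapse M w ! Suc i) \<in> {Lt, Eq})}"

definition gt_eq_words :: "'a opm \<Rightarrow> 'a list set" where
  "gt_eq_words M = {w. length (collapse M w) \<le> 1 \<or>
     (\<forall>i. Suc i < length (collapse M w) \<longrightarrow>
       M (collapse M w ! i) (collapse M w ! Suc i) \<in> {Gt, Eq})}"


section \<open>Chain equivalence and syntactic congruence\<close>

definition chain_equiv :: "'a opm \<Rightarrow> 'a list \<Rightarrow> 'a list \<Rightarrow> bool" where
  "chain_equiv M x y \<longleftrightarrow>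
     first x = first y \<and> final x = final y \<and>
     (\<forall>u v u\<^sub>0 v\<^sub>0. u\<^sub>0 @ word (first x) \<in> gt_eq_words M \<and> word (final x) @ v\<^sub>0 \<in> lt_eq_words M \<longrightarrow>
        (chain_in M u (u\<^sub>0 @ x @ v\<^sub>0) v \<longleftrightarrow> chain_in M u (u\<^sub>0 @ y @ v\<^sub>0) v))"

definition syntactic_congruence :: "'a opm \<Rightarrow> 'a list set \<Rightarrow> 'a list \<Rightarrow> 'a list \<Rightarrow> bool" where
  "syntactic_congruence M L x y \<longleftrightarrow>
     chain_equiv M x y \<and>
     (\<forall>u v u\<^sub>0 v\<^sub>0. u\<^sub>0 @ word (first x) \<in> gt_eq_words M \<and> word (final x) @ v\<^sub>0 \<in> lt_eq_words M \<and>
        chain_in M u (u\<^sub>0 @ x @ v\<^sub>0) v \<longrightarrow>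
        (u @ u\<^sub>0 @ x @ v\<^sub>0 @ v \<in> L \<longleftrightarrow> u @ u\<^sub>0 @ y @ v\<^sub>0 @ v \<in> L))"


section \<open>Decidable relations on words\<close>

text \<open>
  Computability is that of Kleene's partial recursive functions. \<open>rec_eval f xs y\<close>: the function
  denoted by \<open>f\<close> is defined at the arguments \<open>xs\<close>, with value \<open>y\<close>.
\<close>

datatype recf =
    Zero
  | Succ
  | Proj nat
  | Comp recf "recf list"
  | Prec recf recf
  | Mu recf

inductive rec_eval :: "recf \<Rightarrow> nat list \<Rightarrow> nat \<Rightarrow> bool" where
  "rec_eval Zero xs 0"
| "rec_eval Succ [x] (Suc x)"
| "i < length xs \<Longrightarrow> rec_eval (Proj i) xs (xs ! i)"
| "\<lbrakk> list_all2 (\<lambda>g y. rec_eval g xs y) gs ys; rec_eval f ys z \<rbrakk> \<Longrightarrow> rec_eval (Comp f gs) xs z"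
| "rec_eval f xs y \<Longrightarrow> rec_eval (Prec f g) (0 # xs) y"
| "\<lbrakk> rec_eval (Prec f g) (n # xs) r; rec_eval g (n # r # xs) y \<rbrakk>
     \<Longrightarrow> rec_eval (Prec f g) (Suc n # xs) y"
| "\<lbrakk> rec_eval f (n # xs) 0; \<forall>m<n. \<exists>y. rec_eval f (m # xs) (Suc y) \<rbrakk> \<Longrightarrow> rec_eval (Mu f) xs n"

inductive_cases rec_eval_cases:
  "rec_eval Zero xs y" "rec_eval Succ xs y" "rec_eval (Proj i) xs y" "rec_eval (Comp f gs) xs y"
  "rec_eval (Prec f g) (0 # xs) y" "rec_eval (Prec f g) (Suc n # xs) y" "rec_eval (Mu f) xs y"

lemma rec_eval_deterministic: "rec_eval f xs y \<Longrightarrow> rec_eval f xs z \<Longrightarrow> y = z"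
proof (induction arbitrary: z rule: rec_eval.induct)
  case (4 xs gs ys f y)
  from \<open>rec_eval (Comp f gs) xs z\<close> obtain zs
    where zs: "list_all2 (\<lambda>g y. rec_eval g xs y) gs zs" "rec_eval f zs z"
    by (auto elim: rec_eval_cases)
  from 4(1) zs(1) have "ys = zs"
    by (simp add: list_all2_conv_all_nth list_eq_iff_nth_eq)
  with 4 zs show ?case by blast
next
  case (6 f g n xs r y)
  from \<open>rec_eval (Prec f g) (Suc n # xs) z\<close> obtain r'
    where "rec_eval (Prec f g) (n # xs) r'" "rec_eval g (n # r' # xs) z"
    by (blast elim: rec_eval_cases)
  with 6 show ?case by blast
next
  case (7 f n xs)
  from \<open>rec_eval (Mu f) xs z\<close>
  have z: "rec_eval f (z # xs) 0" "\<forall>m<z. \<exists>y. rec_eval f (m # xs) (Suc y)"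
    by (auto elim: rec_eval_cases(7))
  have "\<not> n < z" using 7 z(2) by (metis nat.distinct(1))
  moreover have "\<not> z < n" using 7 z(1) by (metis nat.distinct(1))
  ultimately show ?case by simp
qed (blast elim: rec_eval_cases)+

text \<open>
  Letters are numbered by an arbitrary injection, which is harmless for a finite alphabet, and
  words are coded letter by letter. (\<open>to_nat\<close> at type \<open>'a list\<close> would be an arbitrary, possibly
  non-computable, coding of words.)
\<close>

definition code_word :: "'a::finite list \<Rightarrow> nat" where
  "code_word w = list_encode (map to_nat w)"

definition decidable :: "('a::finite list \<Rightarrow> 'a list \<Rightarrow> bool) \<Rightarrow> bool" where
  "decidable R \<longleftrightarrow>
     (\<exists>f. \<forall>x y. rec_eval f [code_word x, code_word y] (if R x y then 1 else 0))"


section \<open>Language abstractions\<close>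

definition chain_monotonic :: "'a opm \<Rightarrow> ('a list \<Rightarrow> 'a list \<Rightarrow> bool) \<Rightarrow> bool" where
  "chain_monotonic M R \<longleftrightarrow>
     (\<forall>x y u v u\<^sub>0 v\<^sub>0. R x y \<and>
        (\<forall>z \<in> {x, y}. u\<^sub>0 @ word (first z) \<in> gt_eq_words M \<and>
           word (final z) @ v\<^sub>0 \<in> lt_eq_words M \<and> chain_in M u (u\<^sub>0 @ z @ v\<^sub>0) v) \<longrightarrow>
        R (u @ u\<^sub>0 @ x @ v\<^sub>0 @ v) (u @ u\<^sub>0 @ y @ v\<^sub>0 @ v))"

definition well_quasi_order :: "('b \<Rightarrow> 'b \<Rightarrow> bool) \<Rightarrow> bool" where
  "well_quasi_order R \<longleftrightarrow> reflp R \<and> transp R \<and>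
     (\<forall>Y. \<exists>X. finite X \<and> X \<subseteq> Y \<and> (\<forall>y\<in>Y. \<exists>x\<in>X. R x y))"

definition saturates :: "('b \<Rightarrow> 'b \<Rightarrow> bool) \<Rightarrow> 'b set \<Rightarrow> bool" where
  "saturates R L \<longleftrightarrow> (\<forall>w\<^sub>0 w. R w\<^sub>0 w \<and> w\<^sub>0 \<in> L \<longrightarrow> w \<in> L)"

definition language_abstraction ::
    "'a::finite opm \<Rightarrow> 'a list set \<Rightarrow> ('a list \<Rightarrow> 'a list \<Rightarrow> bool) \<Rightarrow> bool" where
  "language_abstraction M L R \<longleftrightarrow>
     decidable R \<and> chain_monotonic M R \<and> well_quasi_order R \<and> saturates R L"


section \<open>Operator precedence automata\<close>

record ('a, 'q) opa =
  states :: "'q set"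
  initial :: "'q set"
  accepting :: "'q set"
  push_trans :: "('q \<times> 'a \<times> 'q) set"
  shift_trans :: "('q \<times> 'a \<times> 'q) set"
  pop_trans :: "('q \<times> 'q \<times> 'q) set"

definition opa :: "('a, 'q) opa \<Rightarrow> bool" where
  "opa A \<longleftrightarrow>
     finite (states A) \<and> initial A \<subseteq> states A \<and> accepting A \<subseteq> states A \<and>
     push_trans A \<subseteq> states A \<times> UNIV \<times> states A \<and>
     shift_trans A \<subseteq> states A \<times> UNIV \<times> states A \<and>
     pop_trans A \<subseteq> states A \<times> states A \<times> states A"

text \<open>A configuration consists of the state, the remaining input, and the stack (top first).\<close>

type_synonym ('a, 'q) config = "'q \<times> 'a list \<times> ('a \<times> 'q) list"

inductive opa_step :: "'a opm \<Rightarrow> ('a, 'q) opa \<Rightarrow> ('a, 'q) config \<Rightarrow> ('a, 'q) config \<Rightarrow> bool"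
  for M :: "'a opm" and A :: "('a, 'q) opa" where
  push: "\<lbrakk> \<theta> = [] \<or> M (fst (hd \<theta>)) a = Lt; (s, a, t) \<in> push_trans A \<rbrakk>
     \<Longrightarrow> opa_step M A (s, a # w, \<theta>) (t, w, (a, s) # \<theta>)"
| shift: "\<lbrakk> M a' a = Eq; (s, a, t) \<in> shift_trans A \<rbrakk>
     \<Longrightarrow> opa_step M A (s, a # w, (a', q) # \<theta>) (t, w, (a, q) # \<theta>)"
| pop: "\<lbrakk> eprec M (Some a') (first w) = Gt; (s, q, t) \<in> pop_trans A \<rbrakk>
     \<Longrightarrow> opa_step M A (s, w, (a', q) # \<theta>) (t, w, \<theta>)"

definition opa_language :: "'a opm \<Rightarrow> ('a, 'q) opa \<Rightarrow> 'a list set" where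
  "opa_language M A =
     {w. \<exists>q\<^sub>0 \<in> initial A. \<exists>q\<^sub>F \<in> accepting A. (opa_step M A)\<^sup>*\<^sup>* (q\<^sub>0, w, []) (q\<^sub>F, [], [])}"

text \<open>Up to renaming, the states of any automaton are natural numbers.\<close>

definition op_language :: "'a opm \<Rightarrow> 'a list set \<Rightarrow> bool" where
  "op_language M L \<longleftrightarrow> (\<exists>A :: ('a, nat) opa. opa A \<and> opa_language M A = L)"

end

theory Submission imports Defs begin

text \<open>
  A deterministic shift-reduce parser, whose stack entries carry relations on the states of an
  automaton, recognises the chains and runs the determinised automaton at the same time. In a
  context \<open>u u\<^sub>0 x v\<^sub>0 v\<close> as in the congruence, the condition on \<open>u\<^sub>0\<close> says that the parser starts
  \<open>x\<close> with at most one open group above the left delimiter, and the condition on \<open>v\<^sub>0\<close> says that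
  only the topmost entry left by \<open>x\<close> is touched before everything is popped by \<open>v\<close>. Hence the class
  of \<open>x\<close> is determined by finite data: for each of the finitely many initial stacks, the topmost
  entry after reading \<open>x\<close> and the effect of popping the entries below it. So the congruence has
  finite index, which makes it a well quasi-order, and it is decidable because the parser is a
  recursive function. Chain-monotonicity follows by merging nested contexts, and saturation because
  every nonempty word is a chain between empty delimiters.
\<close>

section \<open>Recursive functions\<close>

text \<open>The congruence quantifies over infinitely many contexts, and \<open>collapse\<close> is
  a chosen normal form, so neither yields an algorithm directly. Both become statements about
  stacks: a chain is a body that reduces to its left delimiter, and the side conditions bound how
  far a context reaches into the stack. Two obstacles shape the development. The side conditions are
  judged without the delimiters of the chain in which they occur, so stacks over different left
  delimiters have to be compared. And the stack after a word is meaningful only up to the pops that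
  the next letter forces, hence the many equations between reduced stacks. Decidability does not
  come from computing with the congruence itself: a finite table, which exists by finiteness of the
  set of invariant values, tells which pairs of values are congruent, and the invariants are
  computed from finitely many constants that depend on the automaton.\<close>

definition computable :: "nat \<Rightarrow> (nat list \<Rightarrow> nat) \<Rightarrow> bool" where
  "computable n F \<longleftrightarrow> (\<exists>f. \<forall>xs. length xs = n \<longrightarrow> rec_eval f xs (F xs))"

lemma computable_cong: "(\<And>xs. length xs = n \<Longrightarrow> F xs = G xs) \<Longrightarrow> computable n F \<Longrightarrow> computable n G"
  unfolding computable_def by metis

lemma computable_nth: "i < n \<Longrightarrow> computable n (\<lambda>xs. xs ! i)"
  unfolding computable_def by (intro exI[of _ "Proj i"]) (auto intro: rec_eval.intros)

lemma computable_comp: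
  assumes "computable (length Fs) G" "\<forall>F\<in>set Fs. computable n F"
  shows "computable n (\<lambda>xs. G (map (\<lambda>F. F xs) Fs))"
proof -
  from assms(1) obtain g where g: "rec_eval g ys (G ys)" if "length ys = length Fs" for ys
    unfolding computable_def by blast
  from assms(2) obtain c where c: "\<And>F xs. F \<in> set Fs \<Longrightarrow> length xs = n \<Longrightarrow> rec_eval (c F) xs (F xs)"
    unfolding computable_def by metis
  have "rec_eval (Comp g (map c Fs)) xs (G (map (\<lambda>F. F xs) Fs))" if "length xs = n" for xs
    by (rule rec_eval.intros(4)[of _ _ "map (\<lambda>F. F xs) Fs"])
      (use g c that in \<open>auto simp: list_all2_conv_all_nth\<close>)
  then show ?thesis unfolding computable_def by blast
qed

text \<open>Primitive recursion puts a counter and an accumulator in front of the parameters,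
  minimisation a candidate. Functions of the parameters alone have to be usable behind these extra
  arguments.\<close>

lemma computable_drop:
  assumes "computable n F"
  shows "computable (k + n) (\<lambda>ys. F (drop k ys))"
proof -
  have "computable (k + n) (\<lambda>ys. F (map (\<lambda>G. G ys) (map (\<lambda>i ys. ys ! (k + i)) [0..<n])))"
    by (rule computable_comp) (use assms in \<open>auto intro: computable_nth\<close>)
  then show ?thesis
    by (rule computable_cong[rotated]) (auto intro!: arg_cong[of _ _ F] nth_equalityI)
qed

lemma computable_drop2: "computable n F \<Longrightarrow> computable (Suc (Suc n)) (\<lambda>ys. F (drop 2 ys))"
  using computable_drop[of n F 2] by simp

lemma computable_drop1: "computable n F \<Longrightarrow> computable (Suc n) (\<lambda>ys. F (drop 1 ys))"
  using computable_drop[of n F 1] by simp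

lemma computable_Suc:
  assumes "computable n F"
  shows "computable n (\<lambda>xs. Suc (F xs))"
proof -
  have "computable 1 (\<lambda>xs. Suc (xs ! 0))"
    unfolding computable_def
    by (intro exI[of _ Succ]) (auto simp: length_Suc_conv intro: rec_eval.intros)
  with computable_comp[of "[F]" "\<lambda>xs. Suc (xs ! 0)" n] assms show ?thesis by simp
qed

lemma computable_const: "computable n (\<lambda>xs. c)"
proof (induction c)
  case 0
  show ?case unfolding computable_def by (auto intro: rec_eval.intros)
qed (rule computable_Suc)

lemma computable_rec_nat:
  assumes "computable n F" "computable (Suc (Suc n)) (\<lambda>ys. G (ys ! 0) (ys ! 1) (drop 2 ys))" "computable n K"
  shows "computable n (\<lambda>xs. rec_nat (F xs) (\<lambda>m r. G m r xs) (K xs))"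
proof -
  from assms(1) obtain f where f: "rec_eval f xs (F xs)" if "length xs = n" for xs
    unfolding computable_def by blast
  from assms(2) obtain g where g: "rec_eval g ys (G (ys ! 0) (ys ! 1) (drop 2 ys))" if "length ys = Suc (Suc n)" for ys
    unfolding computable_def by blast
  have rec: "rec_eval (Prec f g) (k # xs) (rec_nat (F xs) (\<lambda>m r. G m r xs) k)" if "length xs = n" for k xs
  proof (induction k)
    case 0
    from f[OF that] show ?case by (auto intro: rec_eval.intros)
  next
    case (Suc k)
    from rec_eval.intros(6)[OF Suc g[of "k # _ # xs"]] that show ?case by simp
  qed
  have "computable (Suc n) (\<lambda>ys. rec_nat (F (tl ys)) (\<lambda>m r. G m r (tl ys)) (hd ys))"
    unfolding computable_def by (intro exI[of _ "Prec f g"]) (auto simp: length_Suc_conv rec)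
  \<comment> \<open>\<open>Prec\<close> recurses on its first argument, so composition places the
    bound \<open>K\<close> there and the unchanged parameters behind it.\<close>
  then have "computable n (\<lambda>xs. (\<lambda>ys. rec_nat (F (tl ys)) (\<lambda>m r. G m r (tl ys)) (hd ys))
      (map (\<lambda>H. H xs) (K # map (\<lambda>i xs. xs ! i) [0..<n])))"
    by (intro computable_comp) (use assms(3) in \<open>auto intro: computable_nth\<close>)
  then show ?thesis
  proof (rule computable_cong[rotated], goal_cases)
    case (1 xs)
    then have "map (\<lambda>H. H xs) (map (\<lambda>i xs. xs ! i) [0..<n]) = xs" by (auto intro!: nth_equalityI)
    then show ?case by simp
  qed
qed

lemma computable_Least:
  assumes "computable (Suc n) (\<lambda>ys. G (ys ! 0) (drop 1 ys))" "\<And>xs. \<exists>m. G m xs = 0"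
  shows "computable n (\<lambda>xs. LEAST m. G m xs = 0)"
proof -
  from assms(1) obtain g where g: "rec_eval g ys (G (ys ! 0) (drop 1 ys))" if "length ys = Suc n" for ys
    unfolding computable_def by blast
  have g': "rec_eval g (m # xs) (G m xs)" if "length xs = n" for m xs
    using g[of "m # xs"] that by simp
  have "rec_eval (Mu g) xs (LEAST m. G m xs = 0)" if "length xs = n" for xs
  proof (rule rec_eval.intros(7))
    show "rec_eval g ((LEAST m. G m xs = 0) # xs) 0"
      using g'[OF that, of "LEAST m. G m xs = 0"] LeastI_ex[OF assms(2)[of xs]] by simp
    show "\<forall>m<LEAST m. G m xs = 0. \<exists>y. rec_eval g (m # xs) (Suc y)"
      using g'[OF that] not_less_Least by (metis not0_implies_Suc)
  qed
  then show ?thesis unfolding computable_def by blast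
qed

lemma computable_if:
  assumes "computable n C" "computable n A" "computable n B"
  shows "computable n (\<lambda>xs. if C xs = 0 then A xs else B xs)"
proof -
  have "computable n (\<lambda>xs. rec_nat (A xs) (\<lambda>m r. B xs) (C xs))"
    by (intro computable_rec_nat computable_drop2 assms)
  then show ?thesis
  proof (rule computable_cong[rotated], goal_cases)
    case (1 xs)
    then show ?case by (cases "C xs") auto
  qed
qed

lemma computable_funpow:
  assumes "computable (Suc (Suc n)) (\<lambda>ys. g (ys ! 1) (drop 2 ys))" "computable n K" "computable n S"
  shows "computable n (\<lambda>xs. ((\<lambda>s. g s xs) ^^ K xs) (S xs))"
proof -
  have "computable n (\<lambda>xs. rec_nat (S xs) (\<lambda>m r. g r xs) (K xs))"
    by (intro computable_rec_nat assms)
  moreover have "rec_nat s (\<lambda>m r. h r) k = (h ^^ k) s" for s k and h :: "nat \<Rightarrow> nat"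
    by (induction k) auto
  ultimately show ?thesis by simp
qed

lemma computable_add:
  assumes "computable n F" "computable n G"
  shows "computable n (\<lambda>xs. F xs + G xs)"
proof -
  have "computable n (\<lambda>xs. rec_nat (F xs) (\<lambda>m r. Suc r) (G xs))"
    by (intro computable_rec_nat assms computable_Suc computable_nth) simp
  moreover have "rec_nat a (\<lambda>m r. Suc r) b = a + b" for a b by (induction b) auto
  ultimately show ?thesis by simp
qed

lemma computable_pred:
  assumes "computable n F"
  shows "computable n (\<lambda>xs. F xs - 1)"
proof -
  have "computable n (\<lambda>xs. rec_nat 0 (\<lambda>m r. m) (F xs))"
    by (intro computable_rec_nat assms computable_const computable_nth) simp
  moreover have "rec_nat 0 (\<lambda>m r. m) b = b - 1" for b :: nat by (cases b) auto
  ultimately show ?thesis by simp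
qed

lemma computable_diff:
  assumes "computable n F" "computable n G"
  shows "computable n (\<lambda>xs. F xs - G xs)"
proof -
  have "computable n (\<lambda>xs. rec_nat (F xs) (\<lambda>m r. r - 1) (G xs))"
    by (intro computable_rec_nat assms computable_pred computable_nth) simp
  moreover have "rec_nat a (\<lambda>m r. r - 1) b = a - b" for a b :: nat by (induction b) auto
  ultimately show ?thesis by simp
qed

section \<open>Cantor pairing and codes of lists\<close>

lemma computable_triangle:
  assumes "computable n F"
  shows "computable n (\<lambda>xs. triangle (F xs))"
proof -
  have "computable n (\<lambda>xs. rec_nat 0 (\<lambda>m r. r + Suc m) (F xs))"
    by (intro computable_rec_nat assms computable_add computable_Suc computable_const computable_nth) simp_all
  moreover have "rec_nat 0 (\<lambda>m r. r + Suc m) b = triangle b" for b by (induction b) auto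
  ultimately show ?thesis by simp
qed

lemma computable_prod_encode:
  "computable n F \<Longrightarrow> computable n G \<Longrightarrow> computable n (\<lambda>xs. prod_encode (F xs, G xs))"
  unfolding prod_encode_def by (simp add: computable_add computable_triangle)

text \<open>The Cantor diagonal of \<open>k\<close>, that is the sum of the coded pair: the d with
  \<open>triangle d\<close> \<le> k < \<open>triangle (Suc d)\<close>. The upper bound is written as
  a vanishing truncated difference so that minimisation applies.\<close>

definition diagonal :: "nat \<Rightarrow> nat" where
  "diagonal k = (LEAST d. Suc k - triangle (Suc d) = 0)"

lemma diagonal_prod_encode: "diagonal (prod_encode (i, j)) = i + j"
  unfolding diagonal_def
proof (rule Least_equality)
  fix d assume *: "Suc (prod_encode (i, j)) - triangle (Suc d) = 0"
  show "i + j \<le> d"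
  proof (rule ccontr)
    assume "\<not> i + j \<le> d"
    then have "Suc d \<le> i + j" by simp
    then have "triangle (Suc d) \<le> triangle (i + j)"
      unfolding triangle_def by (intro div_le_mono mult_le_mono) auto
    with * show False by (simp add: prod_encode_def)
  qed
qed (simp add: prod_encode_def)

lemma computable_diagonal:
  assumes "computable n F"
  shows "computable n (\<lambda>xs. diagonal (F xs))"
  unfolding diagonal_def
proof (rule computable_Least)
  show "computable (Suc n) (\<lambda>ys. Suc (F (drop 1 ys)) - triangle (Suc (ys ! 0)))"
    by (intro computable_diff computable_Suc computable_triangle computable_nth computable_drop1 assms) simp
  show "\<exists>m. Suc (F xs) - triangle (Suc m) = 0" for xs
    by (intro exI[of _ "F xs"]) simp
qed

lemma fst_prod_decode: "fst (prod_decode k) = k - triangle (diagonal k)"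
  and snd_prod_decode: "snd (prod_decode k) = diagonal k - (k - triangle (diagonal k))"
proof -
  obtain i j where k: "k = prod_encode (i, j)" by (metis prod.collapse prod_decode_inverse)
  show "fst (prod_decode k) = k - triangle (diagonal k)"
    "snd (prod_decode k) = diagonal k - (k - triangle (diagonal k))"
    unfolding k by (simp_all add: diagonal_prod_encode) (simp_all add: prod_encode_def)
qed

definition head_code :: "nat \<Rightarrow> nat" where
  "head_code k = (if k = 0 then 0 else fst (prod_decode (k - 1)))"

definition tail_code :: "nat \<Rightarrow> nat" where
  "tail_code k = (if k = 0 then 0 else snd (prod_decode (k - 1)))"

definition cons_code :: "nat \<Rightarrow> nat \<Rightarrow> nat" where
  "cons_code h t = Suc (prod_encode (h, t))"

lemma list_code_simps [simp]:
  "head_code 0 = 0" "tail_code 0 = 0" "head_code (cons_code h t) = h" "tail_code (cons_code h t) = t"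
  "cons_code h t \<noteq> 0" "list_encode (h # xs) = cons_code h (list_encode xs)"
  by (simp_all add: head_code_def tail_code_def cons_code_def)

declare list_encode.simps(2) [simp del]

lemma list_encode_eq_0 [simp]: "list_encode xs = 0 \<longleftrightarrow> xs = []"
  by (cases xs) auto

lemma length_le_list_encode: "length xs \<le> list_encode xs"
  by (induction xs) (auto simp: cons_code_def intro: le_trans[OF _ le_prod_encode_2])

lemma computable_head_code: "computable n F \<Longrightarrow> computable n (\<lambda>xs. head_code (F xs))"
  unfolding head_code_def fst_prod_decode
  by (intro computable_if computable_diff computable_triangle computable_diagonal computable_const)

lemma computable_tail_code: "computable n F \<Longrightarrow> computable n (\<lambda>xs. tail_code (F xs))"
  unfolding tail_code_def snd_prod_decode
  by (intro computable_if computable_diff computable_triangle computable_diagonal computable_const)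

lemma computable_cons_code: "computable n F \<Longrightarrow> computable n G \<Longrightarrow> computable n (\<lambda>xs. cons_code (F xs) (G xs))"
  unfolding cons_code_def by (intro computable_Suc computable_prod_encode)

text \<open>A function of finite support is a finite case distinction: test for 0, otherwise consult
  the shifted table at the predecessor. In this way data that exist but are not computed, on the
  automaton and finally on the congruence, enter a recursive function.\<close>

lemma computable_table:
  assumes "finite {i. h i \<noteq> 0}" "computable n F"
  shows "computable n (\<lambda>xs. h (F xs))"
proof -
  obtain N where "\<forall>i\<in>{i. h i \<noteq> 0}. i < N" using assms(1) finite_nat_set_iff_bounded by auto
  then have "\<forall>i\<ge>N. h i = 0" by (auto simp: not_less[symmetric])
  then show ?thesis using assms(2)
  proof (induction N arbitrary: h F)
    case 0
    then have "(\<lambda>xs. h (F xs)) = (\<lambda>xs. 0)" by auto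
    then show ?case by (simp add: computable_const)
  next
    case (Suc N)
    have "computable n (\<lambda>xs. (\<lambda>i. h (Suc i)) (F xs - 1))"
      by (rule Suc.IH[of "\<lambda>i. h (Suc i)" "\<lambda>xs. F xs - 1"]) (use Suc.prems(1) computable_pred[OF Suc.prems(2)] in simp_all)
    then have "computable n (\<lambda>xs. if F xs = 0 then h 0 else h (Suc (F xs - 1)))"
      by (intro computable_if Suc.prems computable_const)
    then show ?case by (rule computable_cong[rotated]) simp
  qed
qed

lemma computable_table2:
  assumes "finite {(i, j). h i j \<noteq> 0}" "computable n F" "computable n G"
  shows "computable n (\<lambda>xs. h (F xs) (G xs))"
proof -
  have "{k. (case prod_decode k of (i, j) \<Rightarrow> h i j) \<noteq> 0} \<subseteq> prod_encode ` {(i, j). h i j \<noteq> 0}"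
  proof
    fix k assume *: "k \<in> {k. (case prod_decode k of (i, j) \<Rightarrow> h i j) \<noteq> 0}"
    obtain i j where k: "k = prod_encode (i, j)" by (metis prod.collapse prod_decode_inverse)
    with * show "k \<in> prod_encode ` {(i, j). h i j \<noteq> 0}" by (intro image_eqI[of _ _ "(i, j)"]) auto
  qed
  then have "finite {k. (case prod_decode k of (i, j) \<Rightarrow> h i j) \<noteq> 0}"
    using assms(1) finite_surj by blast
  from computable_table[OF this computable_prod_encode[OF assms(2,3)]] show ?thesis by simp
qed

lemma computable_table3:
  assumes "finite {(i, j, k). h i j k \<noteq> 0}" "computable n F" "computable n G" "computable n H"
  shows "computable n (\<lambda>xs. h (F xs) (G xs) (H xs))"
proof -
  let ?h = "\<lambda>i m. case prod_decode m of (j, k) \<Rightarrow> h i j k"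
  have "{(i, m). ?h i m \<noteq> 0} \<subseteq> (\<lambda>(i, j, k). (i, prod_encode (j, k))) ` {(i, j, k). h i j k \<noteq> 0}"
  proof
    fix p assume *: "p \<in> {(i, m). ?h i m \<noteq> 0}"
    obtain i m where p: "p = (i, m)" by (cases p)
    obtain j k where m: "m = prod_encode (j, k)" by (metis prod.collapse prod_decode_inverse)
    with p * show "p \<in> (\<lambda>(i, j, k). (i, prod_encode (j, k))) ` {(i, j, k). h i j k \<noteq> 0}"
      by (intro image_eqI[of _ _ "(i, j, k)"]) simp_all
  qed
  then have "finite {(i, m). ?h i m \<noteq> 0}" using assms(1) finite_surj by blast
  from computable_table2[OF this assms(2) computable_prod_encode[OF assms(3,4)]] show ?thesis by simp
qed


section \<open>Shift-reduce parsing of chains\<close>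

text \<open>The payloads attached by push, shift and merge stay arbitrary. Recognition of chains is
  thus proved once, and relations on states can be put in later.\<close>

locale parser =
  fixes M :: "'a opm" and psh :: "'a \<Rightarrow> 'm" and shf :: "'m \<Rightarrow> 'a \<Rightarrow> 'm" and mrg :: "'m \<Rightarrow> 'm \<Rightarrow> 'm"
begin

text \<open>
  The top of the stack is the head of the list. Its last entry stands for the left delimiter, which
  is never popped and is shifted only if the flag of \<open>advance\<close> is set. The empty list means failure.
\<close>

fun reduce :: "'a option \<Rightarrow> ('a option \<times> 'm) list \<Rightarrow> ('a option \<times> 'm) list" where
  "reduce r (e # d # \<theta>) =
     (if eprec M (fst e) r = Gt then reduce r ((fst d, mrg (snd d) (snd e)) # \<theta>) else e # d # \<theta>)"
| "reduce r \<theta> = \<theta>"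

definition advance :: "bool \<Rightarrow> ('a option \<times> 'm) list \<Rightarrow> 'a \<Rightarrow> ('a option \<times> 'm) list" where
  "advance f \<theta> b = (case reduce (Some b) \<theta> of
       [] \<Rightarrow> []
     | e # \<theta>' \<Rightarrow> (case eprec M (fst e) (Some b) of
           Lt \<Rightarrow> (Some b, psh b) # e # \<theta>'
         | Eq \<Rightarrow> if f \<or> \<theta>' \<noteq> [] then (Some b, shf (snd e) b) # \<theta>' else []
         | Gt \<Rightarrow> []))"

definition run :: "bool \<Rightarrow> ('a option \<times> 'm) list \<Rightarrow> 'a list \<Rightarrow> ('a option \<times> 'm) list" where
  "run f = foldl (advance f)"

abbreviation shape :: "('a option \<times> 'm) list \<Rightarrow> 'a option list" where
  "shape \<equiv> map fst"

lemma run_simps [simp]: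
  "run f \<theta> [] = \<theta>" "run f \<theta> (b # w) = run f (advance f \<theta> b) w"
  "run f \<theta> (v @ w) = run f (run f \<theta> v) w"
  by (simp_all add: run_def)

lemma reduce_eq_Nil [simp]: "reduce r \<theta> = [] \<longleftrightarrow> \<theta> = []"
  by (induction r \<theta> rule: reduce.induct) auto

lemma reduce_stop: "reduce r \<theta> = e # d # \<theta>' \<Longrightarrow> eprec M (fst e) r \<noteq> Gt"
  by (induction r \<theta> rule: reduce.induct) (auto split: if_splits)

lemma reduce_not_Gt [simp]: "eprec M (fst e) r \<noteq> Gt \<Longrightarrow> reduce r (e # \<theta>) = e # \<theta>"
  by (cases \<theta>) auto

lemma reduce_idem [simp]: "reduce r (reduce r \<theta>) = reduce r \<theta>"
  by (induction r \<theta> rule: reduce.induct) auto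

lemma reduce_append: "\<xi> \<noteq> [] \<Longrightarrow> reduce r (\<xi> @ \<theta>) = reduce r (reduce r \<xi> @ \<theta>)"
  by (induction r \<xi> rule: reduce.induct) auto

lemma fst_last_reduce: "\<theta> \<noteq> [] \<Longrightarrow> fst (last (reduce r \<theta>)) = fst (last \<theta>)"
  by (induction r \<theta> rule: reduce.induct) (auto split: if_splits)

text \<open>Popping that gets blocked inside the upper part stays blocked when further entries lie
  below it.\<close>

lemma reduce_append_short:
  assumes "length (reduce r (\<xi> @ \<theta>)) = 1" "\<xi> \<noteq> []" "\<theta> \<noteq> []"
  shows "length (reduce r \<xi>) = 1"
proof (rule ccontr)
  assume "length (reduce r \<xi>) \<noteq> 1"
  then obtain e d \<xi>' where *: "reduce r \<xi> = e # d # \<xi>'"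
    using assms(2) by (metis One_nat_def length_Cons list.size(3) neq_Nil_conv reduce_eq_Nil)
  from reduce_stop[OF this] have "reduce r (\<xi> @ \<theta>) = (e # d # \<xi>') @ \<theta>"
    using assms(2) * by (simp add: reduce_append)
  with assms show False by simp
qed

lemma advance_Nil [simp]: "advance f [] b = []"
  by (simp add: advance_def)

lemma run_Nil_stack [simp]: "run f [] w = []"
  by (induction w) auto

lemma advance_cong: "reduce (Some b) \<theta> = reduce (Some b) \<theta>' \<Longrightarrow> advance f \<theta> b = advance f \<theta>' b"
  by (simp add: advance_def)

lemma advance_Lt [simp]:
  "eprec M (fst e) (Some b) = Lt \<Longrightarrow> advance f (e # \<theta>) b = (Some b, psh b) # e # \<theta>"
  by (simp add: advance_def)

lemma advance_Eq [simp]: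
  "eprec M (fst e) (Some b) = Eq \<Longrightarrow> f \<or> \<theta> \<noteq> [] \<Longrightarrow> advance f (e # \<theta>) b = (Some b, shf (snd e) b) # \<theta>"
  by (simp add: advance_def)

lemma advance_Gt:
  "eprec M (fst e) (Some b) = Gt \<Longrightarrow>
     advance f (e # d # \<theta>) b = advance f ((fst d, mrg (snd d) (snd e)) # \<theta>) b"
  by (rule advance_cong) simp

lemma advance_Gt_base [simp]: "eprec M (fst e) (Some b) = Gt \<Longrightarrow> advance f [e] b = []"
  by (simp add: advance_def)

lemma advance_cases:
  assumes "advance f \<theta> b \<noteq> []"
  obtains (push) e \<theta>' where "reduce (Some b) \<theta> = e # \<theta>'" "eprec M (fst e) (Some b) = Lt"
      "advance f \<theta> b = (Some b, psh b) # e # \<theta>'"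
  | (shift) e \<theta>' where "reduce (Some b) \<theta> = e # \<theta>'" "eprec M (fst e) (Some b) = Eq" "f \<or> \<theta>' \<noteq> []"
      "advance f \<theta> b = (Some b, shf (snd e) b) # \<theta>'"
proof (cases "reduce (Some b) \<theta>")
  case (Cons e \<theta>')
  with assms that show ?thesis
    by (cases "eprec M (fst e) (Some b)") (auto simp: advance_def split: if_splits)
qed (use assms in \<open>simp add: advance_def\<close>)

section \<open>Locality of the parser and its independence of the payloads\<close>

lemma reduce_append_stop:
  "reduce r \<xi> = e # \<xi>' \<Longrightarrow> eprec M (fst e) r \<noteq> Gt \<Longrightarrow> reduce r (\<xi> @ \<theta>) = reduce r \<xi> @ \<theta>"
  by (metis append_Cons list.distinct(1) reduce_append reduce_eq_Nil reduce_not_Gt)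

text \<open>A step that succeeds on \<xi> does not pop its last entry, so entries below are
  untouched. It may shift that entry if \<open>f\<close> is set; in the longer stack this is
  possible if \<open>g\<close> is set or if the entry is no longer the base.\<close>

lemma advance_frame:
  assumes "advance f \<xi> b \<noteq> []" "f \<longrightarrow> g \<or> \<theta> \<noteq> []"
  shows "advance g (\<xi> @ \<theta>) b = advance f \<xi> b @ \<theta>"
  using assms(1)
proof (cases rule: advance_cases)
  case (push e \<theta>')
  then show ?thesis using reduce_append_stop[of "Some b" \<xi> e \<theta>' \<theta>] by (simp add: advance_def)
next
  case (shift e \<theta>')
  then show ?thesis using reduce_append_stop[of "Some b" \<xi> e \<theta>' \<theta>] assms(2)
    by (auto simp add: advance_def)
qed

lemma run_frame:
  "run f \<xi> w \<noteq> [] \<Longrightarrow> f \<longrightarrow> g \<or> \<theta> \<noteq> [] \<Longrightarrow> run g (\<xi> @ \<theta>) w = run f \<xi> w @ \<theta>"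
proof (induction w arbitrary: \<xi>)
  case (Cons b w)
  then have "advance f \<xi> b \<noteq> []" by auto
  with Cons show ?case by (simp add: advance_frame)
qed simp

lemma fst_hd_advance: "advance f \<theta> b \<noteq> [] \<Longrightarrow> fst (hd (advance f \<theta> b)) = Some b"
  by (erule advance_cases) auto

lemma fst_hd_run: "run f \<theta> w \<noteq> [] \<Longrightarrow> w \<noteq> [] \<Longrightarrow> fst (hd (run f \<theta> w)) = final w"
  by (cases w rule: rev_cases) (auto simp: fst_hd_advance final_def)

lemma length_advance: "advance False \<theta> b \<noteq> [] \<Longrightarrow> 2 \<le> length (advance False \<theta> b)"
  by (erule advance_cases) (auto simp: Suc_le_eq)

lemma length_run: "run False \<theta> w \<noteq> [] \<Longrightarrow> w \<noteq> [] \<Longrightarrow> 2 \<le> length (run False \<theta> w)"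
  by (cases w rule: rev_cases) (auto dest: length_advance)

lemma fst_last_advance:
  "advance False \<theta> b \<noteq> [] \<Longrightarrow> fst (last (advance False \<theta> b)) = fst (last \<theta>)"
proof (erule advance_cases)
  fix e \<theta>' assume "reduce (Some b) \<theta> = e # \<theta>'" "advance False \<theta> b = (Some b, psh b) # e # \<theta>'"
  then show ?thesis using fst_last_reduce[of \<theta> "Some b"] by (cases "\<theta> = []") auto
next
  fix e \<theta>' assume "reduce (Some b) \<theta> = e # \<theta>'" "False \<or> \<theta>' \<noteq> []"
    "advance False \<theta> b = (Some b, shf (snd e) b) # \<theta>'"
  then show ?thesis using fst_last_reduce[of \<theta> "Some b"] by (cases "\<theta> = []") auto
qed

lemma fst_last_run: "run False \<theta> w \<noteq> [] \<Longrightarrow> fst (last (run False \<theta> w)) = fst (last \<theta>)"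
proof (induction w arbitrary: \<theta>)
  case (Cons b w)
  then have "advance False \<theta> b \<noteq> []" by auto
  with Cons show ?case by (simp add: fst_last_advance)
qed simp

text \<open>Every decision of the parser depends on letters and delimiters only, so payloads can be
  ignored when only recognition matters.\<close>

lemma shape_reduce: "shape \<theta> = shape \<theta>' \<Longrightarrow> shape (reduce r \<theta>) = shape (reduce r \<theta>')"
proof (induction r \<theta> arbitrary: \<theta>' rule: reduce.induct)
  case (1 r e d \<theta>)
  then obtain e' d' \<theta>'' where "\<theta>' = e' # d' # \<theta>''" "fst e = fst e'" "fst d = fst d'" "shape \<theta> = shape \<theta>''"
    by (auto simp: Cons_eq_map_conv)
  with 1(1)[of "(fst d', mrg (snd d') (snd e')) # \<theta>''"] show ?case by simp
qed (auto simp: Cons_eq_map_conv)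

lemma shape_advance:
  assumes "shape (reduce (Some b) \<theta>) = shape (reduce (Some b) \<theta>')"
  shows "shape (advance f \<theta> b) = shape (advance f \<theta>' b)"
proof (cases "reduce (Some b) \<theta>")
  case Nil
  with assms show ?thesis by (simp add: advance_def)
next
  case (Cons e \<theta>1)
  with assms obtain e' \<theta>1' where "reduce (Some b) \<theta>' = e' # \<theta>1'" "fst e' = fst e" "shape \<theta>1 = shape \<theta>1'"
    by (auto simp: Cons_eq_map_conv)
  with Cons show ?thesis by (cases "eprec M (fst e) (Some b)") (auto simp: advance_def)
qed

lemma shape_run: "shape \<theta> = shape \<theta>' \<Longrightarrow> shape (run f \<theta> w) = shape (run f \<theta>' w)"
proof (induction w arbitrary: \<theta> \<theta>')
  case (Cons b w)
  from Cons.IH[OF shape_advance[OF shape_reduce[OF Cons.prems]]] show ?case by simp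
qed simp

lemma shape_eq_Nil: "shape \<theta> = shape \<theta>' \<Longrightarrow> \<theta> = [] \<longleftrightarrow> \<theta>' = []"
  by (metis map_is_Nil_conv)

lemma shape_length: "shape \<theta> = shape \<theta>' \<Longrightarrow> length \<theta> = length \<theta>'"
  by (metis length_map)

lemma reduce_run_cong:
  assumes "reduce (first v) \<theta> = reduce (first v) \<theta>'"
  shows "reduce None (run f \<theta> v) = reduce None (run f \<theta>' v)"
proof (cases v)
  case (Cons b w)
  with assms have "advance f \<theta> b = advance f \<theta>' b" by (intro advance_cong) (simp add: first_def)
  with Cons show ?thesis by simp
qed (use assms in \<open>simp add: first_def\<close>)

text \<open>\<open>first (v @ word r)\<close> is the lookahead in front of \<open>v\<close> when
  \<open>r\<close> follows \<open>v\<close>. The pops it forces happen anyway, so stacks need to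
  agree only after them.\<close>

lemma shape_reduce_run_cong:
  assumes "shape (reduce (first (v @ word r)) \<theta>) = shape (reduce (first (v @ word r)) \<theta>')"
  shows "shape (reduce r (run f \<theta> v)) = shape (reduce r (run f \<theta>' v))"
proof (cases v)
  case Nil
  with assms show ?thesis by (cases r) (auto simp: first_def)
next
  case (Cons b w)
  with assms have "shape (advance f \<theta> b) = shape (advance f \<theta>' b)"
    by (intro shape_advance) (simp add: first_def)
  with Cons show ?thesis by (auto intro: shape_reduce shape_run)
qed


text \<open>How the parser sees a chain: the body leaves no trace except a new payload of its left
  delimiter. Both sides are reduced because groups open at the end of \<open>y\<close> are closed
  only by the lookahead \<open>r\<close>, which may pop \<open>l\<close> as well. The new payload is
  chosen before \<open>f\<close> and \<theta>, so it does not depend on the surroundings.\<close>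

definition absorbed :: "'a option \<Rightarrow> 'a list \<Rightarrow> 'a option \<Rightarrow> bool" where
  "absorbed l y r \<longleftrightarrow>
     (\<forall>\<rho>. \<exists>\<rho>'. \<forall>f \<theta>. reduce r (run f ((l, \<rho>) # \<theta>) y) = reduce r ((l, \<rho>') # \<theta>))"

lemma absorbed_Nil [simp]: "absorbed l [] r"
  unfolding absorbed_def by auto

text \<open>Induction along the skeleton: its letter \<open>a\<close> is already on the stack, the
  word after it is absorbed, and the next letter replaces it by a shift. After the last letter
  \<open>r\<close> pops the whole group into \<open>l\<close>.\<close>

lemma absorbed_group:
  assumes "length us = Suc (length as)"
    and "\<forall>i \<le> length as. absorbed ((Some a # map Some as @ [r]) ! i) (us ! i) ((Some a # map Some as @ [r]) ! Suc i)"
    and "\<forall>i. Suc i < length (a # as) \<longrightarrow> M ((a # as) ! i) ((a # as) ! Suc i) = Eq"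
    and "eprec M (Some (last (a # as))) r = Gt"
  shows "\<exists>\<rho>'. \<forall>f \<theta>. reduce r (run f ((Some a, \<rho>) # (l, \<rho>0) # \<theta>) (hd us @ concat (map2 (#) as (tl us))))
     = reduce r ((l, \<rho>') # \<theta>)"
  using assms
proof (induction as arbitrary: a us \<rho>)
  case Nil
  then obtain u where us: "us = [u]" by (cases us) auto
  with Nil have "absorbed (Some a) u r" by simp
  then obtain \<rho>' where "\<forall>f \<theta>. reduce r (run f ((Some a, \<rho>) # \<theta>) u) = reduce r ((Some a, \<rho>') # \<theta>)"
    unfolding absorbed_def by blast
  with Nil us show ?case by auto
next
  case (Cons b as)
  then obtain u us' where us: "us = u # us'" by (cases us) auto
  with Cons obtain u' us'' where us': "us' = u' # us''" by (cases us') auto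
  from Cons(3) us have "absorbed (Some a) u (Some b)" by (auto dest: spec[of _ 0])
  then obtain \<rho>' where \<rho>': "\<forall>f \<theta>. reduce (Some b) (run f ((Some a, \<rho>) # \<theta>) u) = reduce (Some b) ((Some a, \<rho>') # \<theta>)"
    unfolding absorbed_def by blast
  have "M a b = Eq" using Cons(4) by (auto dest: spec[of _ 0])
  then have *: "advance f (run f ((Some a, \<rho>) # (l, \<rho>0) # \<theta>) u) b = (Some b, shf \<rho>' b) # (l, \<rho>0) # \<theta>" for f \<theta>
    using advance_cong[OF \<rho>'[rule_format], of f f "(l, \<rho>0) # \<theta>"] by simp
  have "\<exists>\<rho>''. \<forall>f \<theta>. reduce r (run f ((Some b, shf \<rho>' b) # (l, \<rho>0) # \<theta>) (hd us' @ concat (map2 (#) as (tl us'))))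
     = reduce r ((l, \<rho>'') # \<theta>)"
  proof (rule Cons.IH)
    show "length us' = Suc (length as)" using Cons(2) us by simp
    show "\<forall>i \<le> length as. absorbed ((Some b # map Some as @ [r]) ! i) (us' ! i) ((Some b # map Some as @ [r]) ! Suc i)"
    proof (intro allI impI)
      fix i assume "i \<le> length as"
      with Cons(3)[rule_format, of "Suc i"] us
      show "absorbed ((Some b # map Some as @ [r]) ! i) (us' ! i) ((Some b # map Some as @ [r]) ! Suc i)" by simp
    qed
    show "\<forall>i. Suc i < length (b # as) \<longrightarrow> M ((b # as) ! i) ((b # as) ! Suc i) = Eq"
    proof (intro allI impI)
      fix i assume "Suc i < length (b # as)"
      with Cons(4)[rule_format, of "Suc i"] show "M ((b # as) ! i) ((b # as) ! Suc i) = Eq" by simp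
    qed
    show "eprec M (Some (last (b # as))) r = Gt" using Cons(5) by simp
  qed
  with * us us' show ?case by simp
qed

lemma absorbed_composite:
  assumes "skeleton M l as r" "length us = Suc (length as)"
    and "\<forall>i < length us. absorbed ((l # map Some as @ [r]) ! i) (us ! i) ((l # map Some as @ [r]) ! Suc i)"
  shows "absorbed l (hd us @ concat (map2 (#) as (tl us))) r"
  unfolding absorbed_def
proof
  fix \<rho>
  from assms(1) obtain a as' where as: "as = a # as'" by (cases as) (auto simp: skeleton_def)
  from assms(2) obtain u us' where us: "us = u # us'" by (cases us) auto
  with assms(2) as obtain u' us'' where us': "us' = u' # us''" by (cases us') auto
  have "absorbed l u (Some a)" using assms(3) as us by (auto dest: spec[of _ 0])
  then obtain \<rho>' where \<rho>': "\<forall>f \<theta>. reduce (Some a) (run f ((l, \<rho>) # \<theta>) u) = reduce (Some a) ((l, \<rho>') # \<theta>)"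
    unfolding absorbed_def by blast
  have "eprec M l (Some a) = Lt" using assms(1) as by (simp add: skeleton_def)
  then have *: "advance f (run f ((l, \<rho>) # \<theta>) u) a = (Some a, psh a) # (l, \<rho>') # \<theta>" for f \<theta>
    using advance_cong[OF \<rho>'[rule_format], of f f "\<theta>"] by simp
  have "\<exists>\<rho>''. \<forall>f \<theta>. reduce r (run f ((Some a, psh a) # (l, \<rho>') # \<theta>) (hd us' @ concat (map2 (#) as' (tl us'))))
     = reduce r ((l, \<rho>'') # \<theta>)"
  proof (rule absorbed_group)
    show "length us' = Suc (length as')" using assms(2) as us by simp
    show "\<forall>i \<le> length as'. absorbed ((Some a # map Some as' @ [r]) ! i) (us' ! i) ((Some a # map Some as' @ [r]) ! Suc i)"
    proof (intro allI impI)
      fix i assume "i \<le> length as'"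
      with assms(3)[rule_format, of "Suc i"] assms(2) as us
      show "absorbed ((Some a # map Some as' @ [r]) ! i) (us' ! i) ((Some a # map Some as' @ [r]) ! Suc i)" by simp
    qed
  qed (use assms(1) as in \<open>auto simp: skeleton_def\<close>)
  with * as us us' show "\<exists>\<rho>''. \<forall>f \<theta>. reduce r (run f ((l, \<rho>) # \<theta>) (hd us @ concat (map2 (#) as (tl us)))) = reduce r ((l, \<rho>'') # \<theta>)"
    by simp
qed

lemma concat_map2_Nil: "length us = length as \<Longrightarrow> \<forall>u \<in> set us. u = [] \<Longrightarrow> concat (map2 (#) as us) = as"
  by (induction us as rule: list_induct2) auto

lemma chain_absorbed: "chain M l y r \<Longrightarrow> absorbed l y r"
proof (induction rule: chain.induct)
  case (simple l as r)
  \<comment> \<open>A simple chain counts as a composite one whose words between the skeleton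
    letters are all empty.\<close>
  have "absorbed l (hd (replicate (Suc (length as)) []) @ concat (map2 (#) as (tl (replicate (Suc (length as)) [])))) r"
    by (rule absorbed_composite[OF simple]) (auto simp: nth_Cons split: nat.split)
  then show ?case by (simp add: concat_map2_Nil)
next
  case (composite l as r us)
  then show ?case by (intro absorbed_composite) auto
qed

lemma absorbed_length:
  assumes "absorbed l y r"
  shows "length (reduce r (run False [(l, \<rho>)] y)) = 1"
proof -
  from assms obtain \<rho>' where "\<forall>f \<theta>. reduce r (run f ((l, \<rho>) # \<theta>) y) = reduce r ((l, \<rho>') # \<theta>)"
    unfolding absorbed_def by blast
  from this[rule_format, of False "[]"] show ?thesis by simp
qed

end

section \<open>From reduced stacks back to chains\<close>

lemma chain_nonempty: "chain M l y r \<Longrightarrow> y \<noteq> []"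
proof (induction rule: chain.induct)
  case (composite l as r us)
  then show ?case by (cases us; cases as; cases "tl us") (auto simp: skeleton_def)
qed (auto simp: skeleton_def)

text \<open>
  \<open>open_group M l w a\<close>: after the delimiter \<open>l\<close>, the word \<open>w\<close> is an initial part of a chain body
  ending in the letter \<open>a\<close> of its skeleton. Unlike \<open>chain\<close>, it grows to the right as the parser does.
\<close>

inductive open_group :: "'a opm \<Rightarrow> 'a option \<Rightarrow> 'a list \<Rightarrow> 'a \<Rightarrow> bool" for M l where
  first: "u = [] \<or> chain M l u (Some b) \<Longrightarrow> eprec M l (Some b) = Lt \<Longrightarrow> open_group M l (u @ [b]) b"
| extend: "open_group M l w a \<Longrightarrow> u = [] \<or> chain M (Some a) u (Some b) \<Longrightarrow> M a b = Eq \<Longrightarrow>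
    open_group M l (w @ u @ [b]) b"

text \<open>Recovers the lists that \<open>chain.composite\<close> expects. Each word of
  \<open>us\<close> stands before its letter; the word after the last letter is not known yet, hence
  one word fewer than in a composite chain.\<close>

lemma open_groupD:
  assumes "open_group M l w a"
  shows "\<exists>as us. length us = length as \<and> as \<noteq> [] \<and> last as = a \<and> eprec M l (Some (hd as)) = Lt
    \<and> (\<forall>i. Suc i < length as \<longrightarrow> M (as ! i) (as ! Suc i) = Eq)
    \<and> (\<forall>i < length us. us ! i = [] \<or> chain M ((l # map Some as) ! i) (us ! i) ((l # map Some as) ! Suc i))
    \<and> w = concat (map2 (\<lambda>u a. u @ [a]) us as)"
  using assms
proof (induction rule: open_group.induct)
  case (first u b)
  then show ?case by (intro exI[of _ "[b]"] exI[of _ "[u]"]) auto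
next
  case (extend w a u b)
  then obtain as us where *: "length us = length as" "as \<noteq> []" "last as = a" "eprec M l (Some (hd as)) = Lt"
    "\<forall>i. Suc i < length as \<longrightarrow> M (as ! i) (as ! Suc i) = Eq"
    "\<forall>i < length us. us ! i = [] \<or> chain M ((l # map Some as) ! i) (us ! i) ((l # map Some as) ! Suc i)"
    "w = concat (map2 (\<lambda>u a. u @ [a]) us as)" by blast
  have 1: "M ((as @ [b]) ! i) ((as @ [b]) ! Suc i) = Eq" if "Suc i < length (as @ [b])" for i
  proof (cases "Suc i < length as")
    case True then show ?thesis using *(5) by (simp add: nth_append)
  next
    case False
    with that have "i = length as - 1" by simp
    with False *(2,3) extend(3) that show ?thesis by (simp add: nth_append last_conv_nth)
  qed
  have 2: "(us @ [u]) ! i = [] \<or> chain M ((l # map Some (as @ [b])) ! i) ((us @ [u]) ! i) ((l # map Some (as @ [b])) ! Suc i)"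
    if "i < length (us @ [u])" for i
  proof (cases "i < length us")
    case True
    have "(l # map Some (as @ [b])) ! i = (l # map Some as) ! i"
      using True *(1) by (simp add: nth_append nth_Cons split: nat.split)
    with True *(1,6) show ?thesis by (simp add: nth_append)
  next
    case False
    with that have i: "i = length as" using *(1) by simp
    have "(l # map Some (as @ [b])) ! i = Some a"
      using *(2,3) unfolding i by (cases as rule: rev_cases) (auto simp: nth_append)
    with False i *(1) extend(2) show ?thesis by (simp add: nth_append)
  qed
  show ?case
    by (intro exI[of _ "as @ [b]"] exI[of _ "us @ [u]"]) (use * 1 2 in auto)
qed

lemma concat_map2_snoc: "length us = length as \<Longrightarrow> as \<noteq> [] \<Longrightarrow>
  hd (us @ [u]) @ concat (map2 (#) as (tl (us @ [u]))) = concat (map2 (\<lambda>u a. u @ [a]) us as) @ u"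
proof (induction us as rule: list_induct2)
  case (Cons x xs y ys)
  then show ?case by (cases "ys = []"; cases xs) auto
qed simp

text \<open>The word \<open>u\<close> after the last skeleton letter is the one missing from the
  data of a composite chain.\<close>

lemma open_group_close:
  assumes "open_group M l w a" "u = [] \<or> chain M (Some a) u r" "eprec M (Some a) r = Gt"
  shows "chain M l (w @ u) r"
proof -
  from open_groupD[OF assms(1)] obtain as us where *: "length us = length as" "as \<noteq> []" "last as = a" "eprec M l (Some (hd as)) = Lt"
    "\<forall>i. Suc i < length as \<longrightarrow> M (as ! i) (as ! Suc i) = Eq"
    "\<forall>i < length us. us ! i = [] \<or> chain M ((l # map Some as) ! i) (us ! i) ((l # map Some as) ! Suc i)"
    "w = concat (map2 (\<lambda>u a. u @ [a]) us as)" by blast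
  have "chain M l (hd (us @ [u]) @ concat (map2 (#) as (tl (us @ [u])))) r"
  proof (rule chain.composite)
    show "skeleton M l as r" using * assms(3) by (simp add: skeleton_def)
    show "length (us @ [u]) = Suc (length as)" using * by simp
    show "\<forall>i<length (us @ [u]). (us @ [u]) ! i = [] \<or>
       chain M ((l # map Some as @ [r]) ! i) ((us @ [u]) ! i) ((l # map Some as @ [r]) ! Suc i)"
    proof (intro allI impI)
      fix i assume i: "i < length (us @ [u])"
      show "(us @ [u]) ! i = [] \<or>
       chain M ((l # map Some as @ [r]) ! i) ((us @ [u]) ! i) ((l # map Some as @ [r]) ! Suc i)"
      proof (cases "i < length us")
        case True
        have "(l # map Some as @ [r]) ! i = (l # map Some as) ! i"
          using True *(1) by (simp add: nth_append nth_Cons split: nat.split)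
        with True *(1,6) show ?thesis by (simp add: nth_append)
      next
        case False
        with i have i: "i = length as" using *(1) by simp
        have "(l # map Some as @ [r]) ! i = Some a"
          using *(2,3) unfolding i by (cases as rule: rev_cases) (auto simp: nth_append)
        with False i *(1) assms(2) show ?thesis by (simp add: nth_append)
      qed
    qed
  qed
  then show ?thesis using * by (simp add: concat_map2_snoc)
qed

text \<open>The word read so far is cut into open groups, one for each entry above the base. A
  completed chain after the topmost entry is not part of \<open>w\<close>; it stays pending until
  the next letter is pushed or shifted.\<close>

inductive parsed :: "'a opm \<Rightarrow> 'a option list \<Rightarrow> 'a list \<Rightarrow> bool" for M where
  base: "parsed M [l] []"
| group: "parsed M (l # ls) w \<Longrightarrow> open_group M l v a \<Longrightarrow> parsed M (Some a # l # ls) (w @ v)"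

inductive_cases parsed_Cons2: "parsed M (k # l # ls) w"

context parser begin

text \<open>A pop closes the topmost group together with the pending word \<open>u\<close>; the
  resulting chain becomes the pending word after the entry below.\<close>

lemma parsed_reduce:
  assumes "parsed M (shape \<theta>) w" "u = [] \<or> chain M (fst (hd \<theta>)) u r"
  shows "\<exists>w' u'. w @ u = w' @ u' \<and> parsed M (shape (reduce r \<theta>)) w' \<and>
           (u' = [] \<or> chain M (fst (hd (reduce r \<theta>))) u' r)"
  using assms
proof (induction r \<theta> arbitrary: w u rule: reduce.induct)
  case (1 r e d \<theta>)
  show ?case
  proof (cases "eprec M (fst e) r = Gt")
    case True
    from 1(2) obtain w0 v a where w: "fst e = Some a" "w = w0 @ v" "parsed M (fst d # shape \<theta>) w0" "open_group M (fst d) v a"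
      by (auto elim: parsed_Cons2)
    have "chain M (fst d) (v @ u) r" using open_group_close[OF w(4)] w(1) True 1(3) by auto
    with 1(1)[OF True, of w0 "v @ u"] w True show ?thesis by auto
  next
    case False
    with 1 show ?thesis by (intro exI[of _ w] exI[of _ u]) auto
  qed
qed auto

lemma parsed_advance:
  assumes "parsed M (shape \<theta>) w" "advance False \<theta> b \<noteq> []"
  shows "parsed M (shape (advance False \<theta> b)) (w @ [b])"
proof -
  obtain w' u' where *: "w = w' @ u'" "parsed M (shape (reduce (Some b) \<theta>)) w'"
     "u' = [] \<or> chain M (fst (hd (reduce (Some b) \<theta>))) u' (Some b)"
    using parsed_reduce[OF assms(1), of "[]" "Some b"] by auto
  from assms(2) show ?thesis
  proof (cases rule: advance_cases)
    case (push e \<theta>')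
    with * show ?thesis by (auto intro!: parsed.group open_group.first)
  next
    case (shift e \<theta>')
    then obtain d \<theta>'' where \<theta>': "\<theta>' = d # \<theta>''" by (cases \<theta>') auto
    with * shift obtain w0 v a where w: "fst e = Some a" "w' = w0 @ v" "parsed M (fst d # shape \<theta>'') w0" "open_group M (fst d) v a"
      by (auto elim: parsed_Cons2)
    have "open_group M (fst d) (v @ u' @ [b]) b"
      using w * shift by (intro open_group.extend) auto
    with w have "parsed M (Some b # fst d # shape \<theta>'') (w0 @ v @ u' @ [b])"
      by (intro parsed.group)
    with * w shift \<theta>' show ?thesis by simp
  qed
qed

lemma parsed_run:
  "parsed M (shape \<theta>) w \<Longrightarrow> run False \<theta> v \<noteq> [] \<Longrightarrow> parsed M (shape (run False \<theta> v)) (w @ v)"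
proof (induction v arbitrary: \<theta> w)
  case (Cons b v)
  then have "advance False \<theta> b \<noteq> []" by auto
  with Cons parsed_advance[of \<theta> w b] show ?case by fastforce
qed simp

text \<open>One direction is absorption. Conversely, a stack reduced to its base accounts for no
  letter at all, so the whole of \<open>y\<close> is the pending chain after
  \<open>l\<close>.\<close>

lemma chain_iff:
  "chain M l y r \<longleftrightarrow> y \<noteq> [] \<and> length (reduce r (run False [(l, \<rho>)] y)) = 1"
proof
  assume "chain M l y r"
  then show "y \<noteq> [] \<and> length (reduce r (run False [(l, \<rho>)] y)) = 1"
    using chain_nonempty absorbed_length chain_absorbed by blast
next
  let ?\<theta> = "run False [(l, \<rho>)] y"
  assume *: "y \<noteq> [] \<and> length (reduce r ?\<theta>) = 1"
  then have ne: "?\<theta> \<noteq> []" by auto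
  have "parsed M (shape ?\<theta>) ([] @ y)" using ne by (intro parsed_run) (auto intro: parsed.base)
  from parsed_reduce[OF this, of "[]" r] obtain w' u' where
    **: "y = w' @ u'" "parsed M (shape (reduce r ?\<theta>)) w'" "u' = [] \<or> chain M (fst (hd (reduce r ?\<theta>))) u' r"
    unfolding append_Nil append_Nil2 by blast
  from * obtain e where e: "reduce r ?\<theta> = [e]" by (auto simp: length_Suc_conv)
  have "fst e = l" using fst_last_reduce[of ?\<theta> r] fst_last_run[of "[(l, \<rho>)]" y] e ne by simp
  moreover have "w' = []" using **(2) e by (auto elim: parsed.cases)
  ultimately show "chain M l y r" using ** * e by simp
qed

end


section \<open>Collapsed words\<close>

definition normal :: "'a opm \<Rightarrow> 'a list \<Rightarrow> bool" where
  "normal M n \<longleftrightarrow> (\<nexists>v. collapse_step M n v)"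

definition valley :: "'a opm \<Rightarrow> 'a list \<Rightarrow> bool" where
  "valley M n \<longleftrightarrow> (\<forall>i j. i < j \<longrightarrow> Suc j < length n \<longrightarrow> M (n ! i) (n ! Suc i) = Lt \<longrightarrow> M (n ! j) (n ! Suc j) \<noteq> Gt)"

lemma valley_tl: "valley M (c # n) \<Longrightarrow> valley M n"
  unfolding valley_def
proof (intro allI impI)
  fix i j assume *: "\<forall>i j. i < j \<longrightarrow> Suc j < length (c # n) \<longrightarrow>
      M ((c # n) ! i) ((c # n) ! Suc i) = Lt \<longrightarrow> M ((c # n) ! j) ((c # n) ! Suc j) \<noteq> Gt"
    and "i < j" "Suc j < length n" "M (n ! i) (n ! Suc i) = Lt"
  then show "M (n ! j) (n ! Suc j) \<noteq> Gt" using *[rule_format, of "Suc i" "Suc j"] by simp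
qed

lemma valley_not_Gt:
  assumes "valley M (c # b # n)" "M c b = Lt"
  shows "\<forall>i. Suc i < length (b # n) \<longrightarrow> M ((b # n) ! i) ((b # n) ! Suc i) \<noteq> Gt"
proof (intro allI impI)
  fix i assume "Suc i < length (b # n)"
  with assms show "M ((b # n) ! i) ((b # n) ! Suc i) \<noteq> Gt"
    using assms(1)[unfolded valley_def, rule_format, of 0 "Suc i"] by simp
qed

text \<open>An occurrence of \<open>Lt\<close> and a later \<open>Gt\<close> at minimal distance
  have only \<open>Eq\<close> in between. They enclose the body of a simple chain with letters on
  both sides, which could still be collapsed.\<close>

lemma normal_valley:
  assumes "normal M n"
  shows "valley M n"
proof -
  have False if "i < j" "Suc j < length n" "M (n ! i) (n ! Suc i) = Lt" "M (n ! j) (n ! Suc j) = Gt" for i j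
    using that
  proof (induction "j - i" arbitrary: i j rule: less_induct)
    case less
    have Eq: "M (n ! k) (n ! Suc k) = Eq" if "i < k" "k < j" for k
    proof (cases "M (n ! k) (n ! Suc k)")
      case Lt
      with less that show ?thesis by (meson diff_less_mono2)
    next
      case Gt
      have "Suc k < length n" "k - i < j - i" using that less by linarith+
      with less.hyps[of k i] Gt that less show ?thesis by blast
    qed
    define x y z where "x = take (Suc i) n" and "y = drop (Suc i) (take (Suc j) n)" and "z = drop (Suc j) n"
    have n: "n = x @ y @ z"
    proof -
      have "x @ y = take (Suc j) n" unfolding x_def y_def using less(2)
        by (metis append_take_drop_id Suc_leI less_SucI min.absorb1 take_take le_simps(1))
      then show ?thesis unfolding z_def by (metis append.assoc append_take_drop_id)
    qed
    have ly: "length y = j - i" unfolding y_def using less by simp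
    have ny: "y ! k = n ! (Suc i + k)" if "k < length y" for k
      using that less unfolding ly by (simp add: y_def)
    have ne: "x \<noteq> []" "y \<noteq> []" "z \<noteq> []" using less unfolding x_def y_def z_def by auto
    have hd: "hd y = n ! Suc i" using ne(2) ny[of 0] by (simp add: hd_conv_nth)
    have lst: "last y = n ! j" using ne(2) ny[of "j - i - 1"] ly less by (simp add: last_conv_nth)
    have "skeleton M (final x) y (first z)"
    proof -
      have "final x = Some (n ! i)" using ne(1) less unfolding x_def final_def
        by (simp add: take_Suc_conv_app_nth)
      moreover have "first z = Some (n ! Suc j)" using less unfolding z_def first_def
        by (simp add: hd_drop_conv_nth)
      moreover have "M (y ! k) (y ! Suc k) = Eq" if "Suc k < length y" for k
        using Eq[of "Suc i + k"] ny[of k] ny[of "Suc k"] that ly by simp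
      ultimately show ?thesis using less hd lst ne(2) by (simp add: skeleton_def)
    qed
    then have "chain_in M x y z" unfolding chain_in_def by (rule chain.simple)
    with ne have "collapse_step M n (x @ z)" unfolding n by (intro collapse_step.intros)
    with assms show False unfolding normal_def by blast
  qed
  then show ?thesis unfolding valley_def by blast
qed

section \<open>The two classes of collapsed words in terms of stacks\<close>

context parser begin

text \<open>The removed body is absorbed by the entry of its left delimiter and changes only a
  payload. Collapsing removes inner factors only, so the first letter \<open>c\<close> survives and
  can serve as the initial top of the stack.\<close>

lemma shape_run_collapse_step:
  assumes "collapse_step M (c # w) n"
  shows "\<exists>n'. n = c # n' \<and> shape (run f ((Some c, \<rho>) # \<theta>) w) = shape (run f ((Some c, \<rho>) # \<theta>) n')"
  using assms
proof cases
  case (1 x y z)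
  from 1 obtain x' where x: "x = c # x'" by (cases x) auto
  from 1 obtain b z' where z: "z = b # z'" by (cases z) auto
  have w: "w = x' @ y @ z" using 1 x by simp
  let ?S = "run f ((Some c, \<rho>) # \<theta>) x'"
  have "shape (run f (run f ?S y) z) = shape (run f ?S z)"
  proof (cases "?S = []")
    case False
    have "fst (hd ?S) = final x"
      using fst_hd_run[OF False] x by (cases "x' = []") (auto simp: final_def)
    then obtain \<sigma> \<theta>' where S: "?S = (final x, \<sigma>) # \<theta>'" using False by (cases ?S) auto
    have "absorbed (final x) y (Some b)" using 1 z chain_absorbed unfolding chain_in_def first_def by auto
    then obtain \<sigma>' where "reduce (Some b) (run f ((final x, \<sigma>) # \<theta>') y) = reduce (Some b) ((final x, \<sigma>') # \<theta>')"
      unfolding absorbed_def by blast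
    then have "shape (advance f (run f ?S y) b) = shape (advance f ?S b)"
      unfolding S by (intro shape_advance) (auto intro!: shape_reduce)
    from shape_run[OF this, of f z'] show ?thesis unfolding z by simp
  qed simp
  with w 1 x show ?thesis by simp
qed

lemma shape_run_collapse_steps:
  assumes "(collapse_step M)\<^sup>*\<^sup>* (c # w) n"
  shows "\<exists>n'. n = c # n' \<and> shape (run f ((Some c, \<rho>) # \<theta>) w) = shape (run f ((Some c, \<rho>) # \<theta>) n')"
  using assms
proof (induction rule: rtranclp_induct)
  case (step y z)
  then show ?case using shape_run_collapse_step[of c _ z f \<rho> \<theta>] by metis
qed simp

lemma collapse_Cons:
  obtains n where "collapse M (c # w) = c # n" "valley M (c # n)"
    "shape (run f ((Some c, \<rho>) # \<theta>) w) = shape (run f ((Some c, \<rho>) # \<theta>) n)"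
proof -
  obtain n where n: "collapse M (c # w) = c # n"
    "shape (run f ((Some c, \<rho>) # \<theta>) w) = shape (run f ((Some c, \<rho>) # \<theta>) n)"
    using shape_run_collapse_steps[OF collapse_normal_form(1)] by metis
  moreover have "valley M (c # n)"
    using collapse_normal_form(2)[of M "c # w"] n(1) by (intro normal_valley) (simp add: normal_def)
  ultimately show ?thesis using that by blast
qed

lemma length_run_not_Gt:
  assumes "\<forall>i. Suc i < length (c # n) \<longrightarrow> M ((c # n) ! i) ((c # n) ! Suc i) \<noteq> Gt" "f \<or> \<theta> \<noteq> []"
  shows "Suc (length \<theta>) \<le> length (run f ((Some c, \<rho>) # \<theta>) n)"
  using assms
proof (induction n arbitrary: c \<rho> \<theta>)
  case (Cons b n)
  have IH: "Suc (length \<theta>') \<le> length (run f ((Some b, \<rho>') # \<theta>') n)" if "f \<or> \<theta>' \<noteq> []" for \<rho>' \<theta>'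
  proof (rule Cons.IH[OF _ that], intro allI impI)
    fix i assume "Suc i < length (b # n)"
    then show "M ((b # n) ! i) ((b # n) ! Suc i) \<noteq> Gt" using Cons.prems(1)[rule_format, of "Suc i"] by simp
  qed
  have "M c b \<noteq> Gt" using Cons.prems(1) by (auto dest: spec[of _ 0])
  then consider "M c b = Lt" | "M c b = Eq" by (cases "M c b") auto
  then show ?case
  proof cases
    case 1
    with IH[of "(Some c, \<rho>) # \<theta>" "psh b"] show ?thesis by simp
  next
    case 2
    with IH[of \<theta> "shf \<rho> b"] Cons.prems(2) show ?thesis by simp
  qed
qed simp

text \<open>As long as only \<open>Eq\<close> has occurred the base is the sole entry, and a
  \<open>Gt\<close> would make the parser fail. After the first \<open>Lt\<close> the valley form
  excludes \<open>Gt\<close>.\<close>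

lemma run_base_not_Gt:
  assumes "valley M (c # n)" "run True [(Some c, \<rho>)] n \<noteq> []"
  shows "\<forall>i. Suc i < length (c # n) \<longrightarrow> M ((c # n) ! i) ((c # n) ! Suc i) \<noteq> Gt"
  using assms
proof (induction n arbitrary: c \<rho>)
  case (Cons b n)
  have "\<forall>i. Suc i < length (b # n) \<longrightarrow> M ((b # n) ! i) ((b # n) ! Suc i) \<noteq> Gt"
  proof (cases "M c b")
    case Lt
    then show ?thesis using valley_not_Gt Cons.prems by metis
  next
    case Eq
    with Cons.prems show ?thesis by (intro Cons.IH[of _ "shf \<rho> b"]) (auto dest: valley_tl)
  next
    case Gt
    with Cons.prems show ?thesis by simp
  qed
  moreover have "M c b \<noteq> Gt" using Cons.prems by auto
  ultimately show ?case by (auto simp: nth_Cons split: nat.split)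
qed simp

text \<open>With the flag set the base \<open>c\<close> may be shifted but not popped, so survival
  of the parser says that \<open>v\<close> never reaches below the entry of the letter before
  it.\<close>

lemma lt_eq_words_iff: "c # v \<in> lt_eq_words M \<longleftrightarrow> run True [(Some c, \<rho>)] v \<noteq> []"
proof -
  obtain n where n: "collapse M (c # v) = c # n" "valley M (c # n)"
    "shape (run True [(Some c, \<rho>)] v) = shape (run True [(Some c, \<rho>)] n)"
    by (rule collapse_Cons)
  have Lt_Eq: "p \<in> {Lt, Eq} \<longleftrightarrow> p \<noteq> Gt" for p by (cases p) auto
  have "c # v \<in> lt_eq_words M \<longleftrightarrow> (\<forall>i. Suc i < length (c # n) \<longrightarrow> M ((c # n) ! i) ((c # n) ! Suc i) \<noteq> Gt)"
    unfolding lt_eq_words_def mem_Collect_eq n(1) Lt_Eq by auto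
  also have "\<dots> \<longleftrightarrow> run True [(Some c, \<rho>)] n \<noteq> []"
    using length_run_not_Gt[of c n True "[]" \<rho>] run_base_not_Gt[OF n(2)] by auto
  also have "\<dots> \<longleftrightarrow> run True [(Some c, \<rho>)] v \<noteq> []"
    using shape_eq_Nil[OF n(3)] by simp
  finally show ?thesis .
qed

text \<open>\<open>Eq\<close> continues the single group above the empty delimiter, and
  \<open>Gt\<close> closes it and opens another one. The first \<open>Lt\<close> opens a second
  group, which remains because no \<open>Gt\<close> follows in a valley.\<close>

lemma length_run_iff_not_Lt:
  assumes "valley M (c # n)"
  shows "length (run False [(Some c, \<rho>), (None, \<sigma>)] n) = 2 \<longleftrightarrow>
     (\<forall>i. Suc i < length (c # n) \<longrightarrow> M ((c # n) ! i) ((c # n) ! Suc i) \<noteq> Lt)"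
  using assms
proof (induction n arbitrary: c \<rho> \<sigma>)
  case (Cons b n)
  have IH: "length (run False [(Some b, \<rho>'), (None, \<sigma>')] n) = 2 \<longleftrightarrow>
     (\<forall>i. Suc i < length (b # n) \<longrightarrow> M ((b # n) ! i) ((b # n) ! Suc i) \<noteq> Lt)" for \<rho>' \<sigma>'
    using Cons.prems by (intro Cons.IH) (rule valley_tl)
  have *: "(\<forall>i. Suc i < length (c # b # n) \<longrightarrow> M ((c # b # n) ! i) ((c # b # n) ! Suc i) \<noteq> Lt) \<longleftrightarrow>
    M c b \<noteq> Lt \<and> (\<forall>i. Suc i < length (b # n) \<longrightarrow> M ((b # n) ! i) ((b # n) ! Suc i) \<noteq> Lt)"
    by (auto simp: nth_Cons split: nat.split)
  show ?case
  proof (cases "M c b")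
    case Lt
    have "3 \<le> length (run False ((Some b, psh b) # [(Some c, \<rho>), (None, \<sigma>)]) n)"
      using length_run_not_Gt[OF valley_not_Gt[OF Cons.prems Lt], of False "[(Some c, \<rho>), (None, \<sigma>)]" "psh b"] by simp
    with Lt show ?thesis unfolding * by auto
  next
    case Eq
    with IH show ?thesis unfolding * by simp
  next
    case Gt
    then have "advance False [(Some c, \<rho>), (None, \<sigma>)] b = [(Some b, psh b), (None, mrg \<sigma> \<rho>)]"
      by (simp add: advance_Gt)
    with IH Gt show ?thesis unfolding * by simp
  qed
qed simp

lemma gt_eq_words_iff:
  assumes "w \<noteq> []"
  shows "w \<in> gt_eq_words M \<longleftrightarrow> length (run False [(None, \<rho>)] w) = 2"
proof -
  obtain c v where w: "w = c # v" using assms by (cases w) auto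
  obtain n where n: "collapse M (c # v) = c # n" "valley M (c # n)"
    "shape (run False [(Some c, psh c), (None, \<rho>)] v) = shape (run False [(Some c, psh c), (None, \<rho>)] n)"
    by (rule collapse_Cons)
  have Gt_Eq: "p \<in> {Gt, Eq} \<longleftrightarrow> p \<noteq> Lt" for p by (cases p) auto
  have "c # v \<in> gt_eq_words M \<longleftrightarrow> (\<forall>i. Suc i < length (c # n) \<longrightarrow> M ((c # n) ! i) ((c # n) ! Suc i) \<noteq> Lt)"
    unfolding gt_eq_words_def mem_Collect_eq n(1) Gt_Eq by auto
  also have "\<dots> \<longleftrightarrow> length (run False [(Some c, psh c), (None, \<rho>)] n) = 2"
    using length_run_iff_not_Lt[OF n(2)] by simp
  also have "\<dots> \<longleftrightarrow> length (run False [(Some c, psh c), (None, \<rho>)] v) = 2"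
    using shape_length[OF n(3)] by simp
  finally show ?thesis unfolding w by simp
qed

text \<open>Membership in \<open>gt_eq_words\<close> is judged over the empty delimiter, a chain
  over an arbitrary one. Popping never inspects the letter of the base, so the two stacks keep
  differing only there.\<close>

lemma reduce_change_base:
  "\<exists>\<xi>' \<rho>'. reduce r (\<xi> @ [(l, \<rho>)]) = \<xi>' @ [(l, \<rho>')] \<and> reduce r (\<xi> @ [(l', \<rho>)]) = \<xi>' @ [(l', \<rho>')]"
proof (induction "length \<xi>" arbitrary: \<xi> \<rho> rule: less_induct)
  case less
  show ?case
  proof (cases \<xi>)
    case Nil
    then show ?thesis by (intro exI[of _ "[]"] exI[of _ \<rho>]) simp
  next
    case (Cons e \<xi>1)
    show ?thesis
    proof (cases "eprec M (fst e) r = Gt")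
      case False
      then have "reduce r (\<xi> @ [(l, \<rho>)]) = \<xi> @ [(l, \<rho>)]" "reduce r (\<xi> @ [(l', \<rho>)]) = \<xi> @ [(l', \<rho>)]"
        using Cons by simp_all
      then show ?thesis by blast
    next
      case True
      show ?thesis
      proof (cases \<xi>1)
        case Nil
        with True Cons show ?thesis by (intro exI[of _ "[]"] exI[of _ "mrg \<rho> (snd e)"]) simp
      next
        case (Cons d \<xi>2)
        with less[of "(fst d, mrg (snd d) (snd e)) # \<xi>2" \<rho>] True \<open>\<xi> = e # \<xi>1\<close> show ?thesis by simp
      qed
    qed
  qed
qed

lemma advance_change_base:
  assumes "advance False (\<xi> @ [(l, \<rho>)]) b \<noteq> []" "advance False (\<xi> @ [(l', \<rho>)]) b \<noteq> []"
  shows "\<exists>\<xi>' \<rho>'. advance False (\<xi> @ [(l, \<rho>)]) b = \<xi>' @ [(l, \<rho>')] \<and> advance False (\<xi> @ [(l', \<rho>)]) b = \<xi>' @ [(l', \<rho>')]"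
proof -
  obtain \<xi>1 \<rho>1 where *: "reduce (Some b) (\<xi> @ [(l, \<rho>)]) = \<xi>1 @ [(l, \<rho>1)]" "reduce (Some b) (\<xi> @ [(l', \<rho>)]) = \<xi>1 @ [(l', \<rho>1)]"
    using reduce_change_base by blast
  have adv: "advance False (\<xi> @ [(l, \<rho>)]) b = advance False (\<xi>1 @ [(l, \<rho>1)]) b"
    "advance False (\<xi> @ [(l', \<rho>)]) b = advance False (\<xi>1 @ [(l', \<rho>1)]) b"
    using * by (metis advance_cong reduce_idem)+
  show ?thesis
  proof (cases \<xi>1)
    case Nil
    \<comment> \<open>With the flag off, a bare base survives a letter only by a push on top of
      it.\<close>
    then have "eprec M l (Some b) = Lt" "eprec M l' (Some b) = Lt"
      using assms unfolding adv by (cases "eprec M l (Some b)"; cases "eprec M l' (Some b)"; simp add: advance_def)+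
    then show ?thesis unfolding adv Nil by (intro exI[of _ "[(Some b, psh b)]"] exI[of _ \<rho>1]) simp
  next
    case (Cons e \<xi>2)
    have "eprec M (fst e) (Some b) \<noteq> Gt"
      using * Cons by (cases \<xi>2) (auto dest: reduce_stop)
    then consider "eprec M (fst e) (Some b) = Lt" | "eprec M (fst e) (Some b) = Eq" by (cases "eprec M (fst e) (Some b)") auto
    then show ?thesis
    proof cases
      case 1
      then show ?thesis unfolding adv Cons by (intro exI[of _ "(Some b, psh b) # e # \<xi>2"] exI[of _ \<rho>1]) simp
    next
      case 2
      then show ?thesis unfolding adv Cons by (intro exI[of _ "(Some b, shf (snd e) b) # \<xi>2"] exI[of _ \<rho>1]) simp
    qed
  qed
qed

lemma run_change_base:
  assumes "run False (\<xi> @ [(l, \<rho>)]) w \<noteq> []" "run False (\<xi> @ [(l', \<rho>)]) w \<noteq> []"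
  shows "\<exists>\<xi>' \<rho>'. run False (\<xi> @ [(l, \<rho>)]) w = \<xi>' @ [(l, \<rho>')] \<and> run False (\<xi> @ [(l', \<rho>)]) w = \<xi>' @ [(l', \<rho>')]"
  using assms
proof (induction w arbitrary: \<xi> \<rho>)
  case (Cons b w)
  then have "advance False (\<xi> @ [(l, \<rho>)]) b \<noteq> []" "advance False (\<xi> @ [(l', \<rho>)]) b \<noteq> []" by auto
  from advance_change_base[OF this] obtain \<xi>1 \<rho>1 where
    "advance False (\<xi> @ [(l, \<rho>)]) b = \<xi>1 @ [(l, \<rho>1)]" "advance False (\<xi> @ [(l', \<rho>)]) b = \<xi>1 @ [(l', \<rho>1)]" by blast
  with Cons.IH[of \<xi>1 \<rho>1] Cons.prems show ?case by simp
next
  case Nil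
  show ?case by (intro exI[of _ \<xi>] exI[of _ \<rho>]) simp
qed

section \<open>The parser over the empty delimiter\<close>

lemma advance_None_nonempty: "fst (last \<theta>) = None \<Longrightarrow> \<theta> \<noteq> [] \<Longrightarrow> advance False \<theta> b \<noteq> []"
proof -
  assume *: "fst (last \<theta>) = None" "\<theta> \<noteq> []"
  obtain e \<theta>' where \<theta>': "reduce (Some b) \<theta> = e # \<theta>'" using *(2) by (metis neq_Nil_conv reduce_eq_Nil)
  have "\<theta>' = [] \<Longrightarrow> fst e = None" using fst_last_reduce[of \<theta> "Some b"] * \<theta>' by auto
  moreover have "\<theta>' \<noteq> [] \<Longrightarrow> eprec M (fst e) (Some b) \<noteq> Gt"
    using \<theta>' by (cases \<theta>') (auto dest: reduce_stop)
  ultimately show ?thesis using \<theta>'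
    by (cases "\<theta>' = []"; cases "eprec M (fst e) (Some b)") (simp_all add: advance_def)
qed

lemma run_None_nonempty: "fst (last \<theta>) = None \<Longrightarrow> \<theta> \<noteq> [] \<Longrightarrow> run False \<theta> w \<noteq> []"
proof (induction w arbitrary: \<theta>)
  case (Cons b w)
  then have "advance False \<theta> b \<noteq> []" by (intro advance_None_nonempty)
  with Cons show ?case by (simp add: fst_last_advance)
qed simp

lemma fst_butlast_run:
  assumes "\<forall>e \<in> set (butlast \<theta>). fst e \<noteq> None" "run False \<theta> w \<noteq> []"
  shows "\<forall>e \<in> set (butlast (run False \<theta> w)). fst e \<noteq> None"
proof -
  have red: "\<forall>e \<in> set (butlast (reduce r \<theta>)). fst e \<noteq> None" if "\<forall>e \<in> set (butlast \<theta>). fst e \<noteq> None" for r \<theta>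
    using that
  proof (induction r \<theta> rule: reduce.induct)
    case (1 r e d \<theta>)
    then show ?case by (cases "\<theta> = []") auto
  qed auto
  have adv: "\<forall>e \<in> set (butlast (advance False \<theta> b)). fst e \<noteq> None" if "\<forall>e \<in> set (butlast \<theta>). fst e \<noteq> None" for \<theta> b
  proof (cases "advance False \<theta> b = []")
    case False
    then show ?thesis
    proof (cases rule: advance_cases)
      case (push e \<theta>')
      with red[OF that, of "Some b"] show ?thesis by simp
    next
      case (shift e \<theta>')
      with red[OF that, of "Some b"] show ?thesis by simp
    qed
  qed simp
  show ?thesis using assms
  proof (induction w arbitrary: \<theta>)
    case (Cons b w)
    then show ?case using adv[of \<theta> b] by simp
  qed simp
qed

lemma reduce_None:
  assumes "\<forall>e \<in> set (butlast \<theta>). fst e \<noteq> None" "\<theta> \<noteq> []"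
  shows "length (reduce None \<theta>) = 1"
  using assms
proof (induction "None :: 'a option" \<theta> rule: reduce.induct)
  case (1 e d \<theta>)
  then show ?case by (cases "\<theta> = []"; cases "fst e") auto
qed auto

text \<open>The empty delimiter is \<open>Lt\<close> to every letter, so the parser never fails;
  every letter is \<open>Gt\<close> to the end of the input, so all groups are closed there.\<close>

lemma length_reduce_run_None: "length (reduce None (run False [(None, \<rho>)] w)) = 1"
proof (rule reduce_None)
  show ne: "run False [(None, \<rho>)] w \<noteq> []" by (rule run_None_nonempty) auto
  show "\<forall>e \<in> set (butlast (run False [(None, \<rho>)] w)). fst e \<noteq> None" by (rule fst_butlast_run[OF _ ne]) simp
qed

lemma chain_None: "w \<noteq> [] \<Longrightarrow> chain M None w None"
  using chain_iff[of None w None] length_reduce_run_None by blast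

end


section \<open>Monotonicity and saturation\<close>

lemma word_first: "x \<noteq> [] \<Longrightarrow> word (first x) = [hd x]"
  by (simp add: first_def)

lemma word_final: "x \<noteq> [] \<Longrightarrow> word (final x) = [last x]"
  by (simp add: final_def)

lemma first_append: "first (x @ y) = (if x = [] then first y else first x)"
  by (simp add: first_def)

lemma final_append: "final (x @ y) = (if y = [] then final x else final y)"
  by (simp add: final_def)

lemma first_word_first [simp]: "first (word (first x)) = first x"
  by (cases x) (auto simp: first_def)

lemma first_eq_None [simp]: "first x = None \<longleftrightarrow> x = []"
  by (simp add: first_def)

lemma syntactic_congruence_refl: "syntactic_congruence M L x x"
  by (simp add: syntactic_congruence_def chain_equiv_def)

lemma syntactic_congruence_sym: "syntactic_congruence M L x y \<Longrightarrow> syntactic_congruence M L y x"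
  unfolding syntactic_congruence_def chain_equiv_def by simp

lemma syntactic_congruence_trans:
  assumes xy: "syntactic_congruence M L x y" and yz: "syntactic_congruence M L y z"
  shows "syntactic_congruence M L x z"
proof -
  have F: "first y = first x" "final y = final x"
    using xy unfolding syntactic_congruence_def chain_equiv_def by simp_all
  show ?thesis
    using yz xy unfolding syntactic_congruence_def chain_equiv_def F by blast
qed

lemma syntactic_congruence_Nil: "syntactic_congruence M L x y \<Longrightarrow> x = [] \<longleftrightarrow> y = []"
  unfolding syntactic_congruence_def chain_equiv_def by (metis first_eq_None)

context parser begin

text \<open>After \<open>U\<close> and the first letter of \<open>s\<close> the stack has the same
  shape as after that letter alone: one group over the empty delimiter.\<close>

lemma gt_eq_words_append:
  assumes "U @ word (first (s @ [c])) \<in> gt_eq_words M" "s @ [c] \<in> gt_eq_words M"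
  shows "U @ s @ [c] \<in> gt_eq_words M"
proof (cases s)
  case (Cons a t)
  fix \<rho>
  let ?S = "run False [(None, \<rho>)] (U @ [a])"
  have "length ?S = 2" using assms(1) Cons gt_eq_words_iff[of "U @ [a]" \<rho>] by (simp add: first_def)
  then obtain e d where S: "?S = [e, d]" by (auto simp: length_Suc_conv numeral_2_eq_2)
  have "fst e = Some a" using fst_hd_run[of False "[(None, \<rho>)]" "U @ [a]"] S by (simp add: final_def)
  moreover have "fst d = None" using fst_last_run[of "[(None, \<rho>)]" "U @ [a]"] S by simp
  ultimately have "shape ?S = shape (run False [(None, \<rho>)] [a])" using S by simp
  from shape_length[OF shape_run[OF this, of False "t @ [c]"]]
  have "length (run False [(None, \<rho>)] (U @ s @ [c])) = length (run False [(None, \<rho>)] (s @ [c]))"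
    unfolding Cons by simp
  with assms(2) show ?thesis using gt_eq_words_iff[of _ \<rho>] by (metis append_is_Nil_conv list.distinct(1))
qed (use assms in \<open>simp add: first_def\<close>)

text \<open>\<open>v\<close> leaves its last letter on top, and \<open>V\<close> survives over that
  entry alone, hence also with other entries below.\<close>

lemma lt_eq_words_append:
  assumes "d # v \<in> lt_eq_words M" "last (d # v) # V \<in> lt_eq_words M"
  shows "d # v @ V \<in> lt_eq_words M"
proof -
  fix \<rho>
  let ?S = "run True [(Some d, \<rho>)] v"
  have ne: "?S \<noteq> []" using assms(1) lt_eq_words_iff by blast
  then have "fst (hd ?S) = Some (last (d # v))"
    using fst_hd_run[OF ne] by (cases "v = []") (auto simp: final_def)
  then obtain \<sigma> \<xi> where S: "?S = (Some (last (d # v)), \<sigma>) # \<xi>" using ne by (cases ?S) auto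
  have "run True [(Some (last (d # v)), \<sigma>)] V \<noteq> []" using assms(2) lt_eq_words_iff by blast
  from run_frame[OF this, of True \<xi>] this have "run True ?S V \<noteq> []" unfolding S by simp
  then show ?thesis using lt_eq_words_iff[of d "v @ V" \<rho>] by simp
qed

text \<open>Both inner bodies are absorbed by the same entry, so the stacks differ in payloads only
  when \<open>z\<close> begins.\<close>

lemma chain_in_exchange:
  assumes p: "chain M (final (U @ s)) p (first (z @ V))" and q: "chain M (final (U @ s)) q (first (z @ V))"
    and "chain_in M U (s @ p @ z) V"
  shows "chain_in M U (s @ q @ z) V"
proof -
  fix \<rho>
  let ?S = "run False [(final U, \<rho>)] s"
  let ?b = "first (z @ word (first V))"
  have b: "?b = first (z @ V)" by (simp add: first_append)
  have *: "length (reduce (first V) (run False (run False ?S p) z)) = 1"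
    using assms(3) chain_iff[of _ _ _ \<rho>] unfolding chain_in_def by simp
  then have ne: "?S \<noteq> []" by auto
  then have "fst (hd ?S) = final (U @ s)"
    using fst_hd_run[OF ne] by (cases "s = []") (auto simp: final_append)
  then obtain \<sigma> \<xi> where S: "?S = (final (U @ s), \<sigma>) # \<xi>" using ne by (cases ?S) auto
  obtain \<sigma>1 where 1: "reduce ?b (run False ?S p) = reduce ?b ((final (U @ s), \<sigma>1) # \<xi>)"
    using chain_absorbed[OF p] unfolding absorbed_def b S by blast
  obtain \<sigma>2 where 2: "reduce ?b (run False ?S q) = reduce ?b ((final (U @ s), \<sigma>2) # \<xi>)"
    using chain_absorbed[OF q] unfolding absorbed_def b S by blast
  have "shape (reduce (first V) (run False (run False ?S p) z)) = shape (reduce (first V) (run False (run False ?S q) z))"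
    by (rule shape_reduce_run_cong) (unfold 1 2, rule shape_reduce, simp)
  from shape_length[OF this] * have "length (reduce (first V) (run False [(final U, \<rho>)] (s @ q @ z))) = 1" by simp
  with chain_nonempty[OF q] show ?thesis using chain_iff[of _ _ _ \<rho>] unfolding chain_in_def by blast
qed

text \<open>Over the empty delimiter the stack after \<open>U\<close> and the first letter of
  \<open>p\<close> has the shape it has after that letter alone, so the rest of \<open>p\<close> is
  parsed alike. Replacing the base by \<open>l\<close> is harmless provided the parser does not
  fail, which has to be assumed since \<open>l\<close> may be a letter.\<close>

lemma chain_extend_left:
  assumes "chain M None p r" "U @ [hd p] \<in> gt_eq_words M" "run False [(l, \<rho>)] (U @ p) \<noteq> []"
  shows "chain M l (U @ p) r"
proof -
  obtain c t where p: "p = c # t" using chain_nonempty[OF assms(1)] by (cases p) auto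
  let ?A = "run False [(l, \<rho>)] (U @ [c])" and ?B = "run False [(None, \<rho>)] (U @ [c])"
  have A: "?A \<noteq> []" using assms(3) unfolding p by auto
  moreover have "?B \<noteq> []" by (rule run_None_nonempty) auto
  ultimately obtain \<xi> \<rho>1 where 1: "?A = \<xi> @ [(l, \<rho>1)]" "?B = \<xi> @ [(None, \<rho>1)]"
    using run_change_base[of "[]" l \<rho> "U @ [c]" None] by auto
  have "length ?B = 2" using assms(2) gt_eq_words_iff[of "U @ [c]" \<rho>] unfolding p by simp
  with 1 have "length \<xi> = 1" by simp
  then obtain e where e: "\<xi> = [e]" by (auto simp: length_Suc_conv)
  have "fst e = Some c" using fst_hd_run[OF A] 1 e by (simp add: final_def)
  then have sh: "shape ?B = shape (run False [(None, \<rho>)] [c])" using 1 e by simp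
  have "run False ?A t \<noteq> []" using assms(3) unfolding p by simp
  moreover have "run False ?B t \<noteq> []" unfolding 1 by (rule run_None_nonempty) auto
  ultimately obtain \<xi>2 \<rho>2 where 2: "run False ?A t = \<xi>2 @ [(l, \<rho>2)]" "run False ?B t = \<xi>2 @ [(None, \<rho>2)]"
    using run_change_base[of \<xi> l \<rho>1 t None] unfolding 1 by auto
  have "shape (run False ?B t) = shape (run False [(None, \<rho>)] p)"
    using shape_run[OF sh, of False t] unfolding p by simp
  from shape_length[OF shape_reduce[OF this, of r]] assms(1)
  have *: "length (reduce r (run False ?B t)) = 1" using chain_iff[of None p r \<rho>] by simp
  obtain \<xi>3 \<rho>3 where 3: "reduce r (\<xi>2 @ [(l, \<rho>2)]) = \<xi>3 @ [(l, \<rho>3)]" "reduce r (\<xi>2 @ [(None, \<rho>2)]) = \<xi>3 @ [(None, \<rho>3)]"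
    using reduce_change_base by blast
  with * 2 have "length (reduce r (run False ?A t)) = 1" by simp
  then show ?thesis using chain_iff[of l "U @ p" r \<rho>] unfolding p by simp
qed

text \<open>\<open>V\<close> stays above the entry left on top by \<open>p\<close>, so
  \<open>p @ V\<close> is parsed over \<open>l\<close> without touching \<theta>. As
  \<open>r\<close> reduces the whole stack to one entry, it must in particular reduce the part above
  \<theta> to \<open>l\<close>.\<close>

lemma chain_extend_right:
  assumes "chain M l p None" "last p # V \<in> lt_eq_words M"
    "length (reduce r (run False ((l, \<rho>) # \<theta>) (p @ V))) = 1" "\<theta> \<noteq> []"
  shows "chain M l (p @ V) r"
proof -
  let ?S = "run False [(l, \<rho>)] p"
  have pne: "p \<noteq> []" by (rule chain_nonempty[OF assms(1)])
  have ne: "?S \<noteq> []" using assms(1) chain_iff[of l p None \<rho>] by auto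
  obtain \<sigma> \<xi> where S: "?S = (Some (last p), \<sigma>) # \<xi>"
    using fst_hd_run[OF ne pne] ne pne by (cases ?S) (auto simp: final_def)
  have "\<xi> \<noteq> []" using length_run[OF ne pne] S by auto
  have "run True [(Some (last p), \<sigma>)] V \<noteq> []" using assms(2) lt_eq_words_iff by blast
  from run_frame[OF this, of False \<xi>] this \<open>\<xi> \<noteq> []\<close> have ne2: "run False [(l, \<rho>)] (p @ V) \<noteq> []"
    using S by simp
  have "run False ((l, \<rho>) # \<theta>) (p @ V) = run False [(l, \<rho>)] (p @ V) @ \<theta>"
    using run_frame[OF ne2, of False \<theta>] by simp
  then have "length (reduce r (run False [(l, \<rho>)] (p @ V))) = 1"
    using reduce_append_short[OF _ ne2 assms(4)] assms(3) by metis
  with pne show ?thesis using chain_iff[of l "p @ V" r \<rho>] by blast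
qed

text \<open>
  The two nested contexts are merged into one: \<open>U\<^sub>0\<close> becomes part of the outer word if \<open>u\<close> is
  nonempty, but must be absorbed by \<open>u\<^sub>0\<close> if \<open>u\<close> is empty, as the inner chain then says nothing
  about the letter delimiting it in the larger word; likewise for \<open>V\<^sub>0\<close>.
\<close>

lemma syntactic_congruence_context:
  assumes cong: "syntactic_congruence M L x y" and x: "x \<noteq> []"
    and u\<^sub>0: "u\<^sub>0 @ word (first x) \<in> gt_eq_words M" and v\<^sub>0: "word (final x) @ v\<^sub>0 \<in> lt_eq_words M"
    and ch: "chain_in M u (u\<^sub>0 @ x @ v\<^sub>0) v"
    and U\<^sub>0: "U\<^sub>0 @ word (first (u @ u\<^sub>0 @ x @ v\<^sub>0 @ v)) \<in> gt_eq_words M"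
    and V\<^sub>0: "word (final (u @ u\<^sub>0 @ x @ v\<^sub>0 @ v)) @ V\<^sub>0 \<in> lt_eq_words M"
    and Ch: "chain_in M U (U\<^sub>0 @ (u @ u\<^sub>0 @ x @ v\<^sub>0 @ v) @ V\<^sub>0) V"
  shows "chain_in M U (U\<^sub>0 @ (u @ u\<^sub>0 @ y @ v\<^sub>0 @ v) @ V\<^sub>0) V \<and>
    (U @ U\<^sub>0 @ (u @ u\<^sub>0 @ x @ v\<^sub>0 @ v) @ V\<^sub>0 @ V \<in> L \<longleftrightarrow> U @ U\<^sub>0 @ (u @ u\<^sub>0 @ y @ v\<^sub>0 @ v) @ V\<^sub>0 @ V \<in> L)"
proof -
  define s where "s = (if u = [] then [] else U\<^sub>0 @ u)"
  define u\<^sub>1 where "u\<^sub>1 = (if u = [] then U\<^sub>0 @ u\<^sub>0 else u\<^sub>0)"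
  define z where "z = (if v = [] then [] else v @ V\<^sub>0)"
  define v\<^sub>1 where "v\<^sub>1 = (if v = [] then v\<^sub>0 @ V\<^sub>0 else v\<^sub>0)"
  have eq: "U\<^sub>0 @ (u @ u\<^sub>0 @ w @ v\<^sub>0 @ v) @ V\<^sub>0 = s @ (u\<^sub>1 @ w @ v\<^sub>1) @ z" for w
    by (simp add: s_def u\<^sub>1_def z_def v\<^sub>1_def)
  fix \<rho>
  let ?S = "run False [(final U, \<rho>)] (s @ (u\<^sub>1 @ x @ v\<^sub>1) @ z)"
  have len: "length (reduce (first V) ?S) = 1"
    using Ch chain_iff[of _ _ _ \<rho>] unfolding chain_in_def eq by blast
  then have ne: "?S \<noteq> []" by auto
  have "u\<^sub>0 @ [hd x] \<in> gt_eq_words M" using u\<^sub>0 x by (simp add: word_first)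
  then have u\<^sub>1: "u\<^sub>1 @ [hd x] \<in> gt_eq_words M"
    using gt_eq_words_append[of U\<^sub>0 u\<^sub>0 "hd x"] U\<^sub>0 x unfolding u\<^sub>1_def
    by (cases u\<^sub>0) (auto simp: first_append first_def)
  have "[last x] @ v\<^sub>0 \<in> lt_eq_words M" using v\<^sub>0 x by (simp add: word_final)
  then have v\<^sub>1: "[last x] @ v\<^sub>1 \<in> lt_eq_words M"
    using lt_eq_words_append[of "last x" v\<^sub>0 V\<^sub>0] V\<^sub>0 x unfolding v\<^sub>1_def
    by (cases "v\<^sub>0 = []") (auto simp: final_append final_def)
  \<comment> \<open>For \<open>u\<close> and \<open>v\<close> both nonempty this is the inner chain,
    for both empty the outer one. In the mixed cases the inner chain is extended on the side of its
    empty delimiter.\<close>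
  have ch1: "chain M (final (U @ s)) (u\<^sub>1 @ x @ v\<^sub>1) (first (z @ V))"
  proof (cases "u = []")
    case u: True
    show ?thesis
    proof (cases "v = []")
      case True
      with u Ch show ?thesis unfolding chain_in_def s_def u\<^sub>1_def z_def v\<^sub>1_def by simp
    next
      case v: False
      have "chain M (final U) (U\<^sub>0 @ (u\<^sub>0 @ x @ v\<^sub>0)) (first v)"
      proof (rule chain_extend_left)
        show "chain M None (u\<^sub>0 @ x @ v\<^sub>0) (first v)" using ch u unfolding chain_in_def by (simp add: final_def)
        show "U\<^sub>0 @ [hd (u\<^sub>0 @ x @ v\<^sub>0)] \<in> gt_eq_words M"
          using U\<^sub>0 u x by (cases u\<^sub>0) (simp_all add: first_def)
        show "run False [(final U, \<rho>)] (U\<^sub>0 @ u\<^sub>0 @ x @ v\<^sub>0) \<noteq> []"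
        proof
          assume "run False [(final U, \<rho>)] (U\<^sub>0 @ u\<^sub>0 @ x @ v\<^sub>0) = []"
          then have "?S = []" using u v by (simp add: s_def u\<^sub>1_def z_def v\<^sub>1_def)
          with ne show False by simp
        qed
      qed
      with u v show ?thesis by (simp add: s_def u\<^sub>1_def z_def v\<^sub>1_def first_append)
    qed
  next
    case u: False
    show ?thesis
    proof (cases "v = []")
      case True
      let ?T = "run False [(final U, \<rho>)] (U\<^sub>0 @ u)"
      have S: "?S = run False ?T ((u\<^sub>0 @ x @ v\<^sub>0) @ V\<^sub>0)" using u True by (simp add: s_def u\<^sub>1_def z_def v\<^sub>1_def)
      have T: "?T \<noteq> []"
      proof
        assume "?T = []"
        then have "?S = []" unfolding S by simp
        with ne show False by simp
      qed
      obtain \<sigma> \<theta> where \<theta>: "?T = (final u, \<sigma>) # \<theta>"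
        using fst_hd_run[OF T] T u by (cases ?T) (auto simp: final_append)
      have "chain M (final u) ((u\<^sub>0 @ x @ v\<^sub>0) @ V\<^sub>0) (first V)"
      proof (rule chain_extend_right)
        show "chain M (final u) (u\<^sub>0 @ x @ v\<^sub>0) None" using ch True unfolding chain_in_def by (simp add: first_def)
        show "last (u\<^sub>0 @ x @ v\<^sub>0) # V\<^sub>0 \<in> lt_eq_words M" using V\<^sub>0 True x by (simp add: final_def)
        show "length (reduce (first V) (run False ((final u, \<sigma>) # \<theta>) ((u\<^sub>0 @ x @ v\<^sub>0) @ V\<^sub>0))) = 1"
          using len unfolding S \<theta> by simp
        show "\<theta> \<noteq> []" using length_run[OF T] u \<theta> by auto
      qed
      with u True show ?thesis by (simp add: s_def u\<^sub>1_def z_def v\<^sub>1_def final_append)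
    next
      case False
      with u ch show ?thesis unfolding chain_in_def by (simp add: s_def u\<^sub>1_def z_def v\<^sub>1_def final_append first_append)
    qed
  qed
  have "chain_in M (U @ s) (u\<^sub>1 @ x @ v\<^sub>1) (z @ V)" using ch1 unfolding chain_in_def by simp
  moreover have "u\<^sub>1 @ word (first x) \<in> gt_eq_words M" "word (final x) @ v\<^sub>1 \<in> lt_eq_words M"
    using u\<^sub>1 v\<^sub>1 x by (simp_all add: word_first word_final)
  ultimately have y: "chain_in M (U @ s) (u\<^sub>1 @ y @ v\<^sub>1) (z @ V)"
    and L: "(U @ s) @ u\<^sub>1 @ x @ v\<^sub>1 @ (z @ V) \<in> L \<longleftrightarrow> (U @ s) @ u\<^sub>1 @ y @ v\<^sub>1 @ (z @ V) \<in> L"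
    using cong[unfolded syntactic_congruence_def chain_equiv_def] by blast+
  have "chain_in M U (s @ (u\<^sub>1 @ y @ v\<^sub>1) @ z) V"
    by (rule chain_in_exchange[OF ch1 y[unfolded chain_in_def] Ch[unfolded eq]])
  moreover have Eq: "U @ U\<^sub>0 @ (u @ u\<^sub>0 @ w @ v\<^sub>0 @ v) @ V\<^sub>0 @ V = (U @ s) @ u\<^sub>1 @ w @ v\<^sub>1 @ (z @ V)" for w
    using arg_cong[OF eq[of w], of "\<lambda>t. U @ t @ V"] by simp
  ultimately show ?thesis using L unfolding eq Eq by blast
qed

lemma chain_monotonic_syntactic_congruence: "chain_monotonic M (syntactic_congruence M L)"
  unfolding chain_monotonic_def
proof (intro allI impI, elim conjE)
  fix x y u v u\<^sub>0 v\<^sub>0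
  assume cong: "syntactic_congruence M L x y"
    and ctx: "\<forall>z\<in>{x, y}. u\<^sub>0 @ word (first z) \<in> gt_eq_words M \<and> word (final z) @ v\<^sub>0 \<in> lt_eq_words M \<and>
      chain_in M u (u\<^sub>0 @ z @ v\<^sub>0) v"
  let ?X = "u @ u\<^sub>0 @ x @ v\<^sub>0 @ v" and ?Y = "u @ u\<^sub>0 @ y @ v\<^sub>0 @ v"
  show "syntactic_congruence M L ?X ?Y"
  proof (cases "x = []")
    case True
    then show ?thesis using syntactic_congruence_Nil[OF cong] syntactic_congruence_refl by simp
  next
    case x: False
    then have y: "y \<noteq> []" using syntactic_congruence_Nil[OF cong] by simp
    have ff: "first x = first y" "final x = final y"
      using cong unfolding syntactic_congruence_def chain_equiv_def by auto
    have F: "first ?X = first ?Y" "final ?X = final ?Y"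
      using ff x y by (simp_all add: first_append final_append)
    note xy = syntactic_congruence_context[OF cong x, of u\<^sub>0 v\<^sub>0 u v]
    note yx = syntactic_congruence_context[OF syntactic_congruence_sym[OF cong] y, of u\<^sub>0 v\<^sub>0 u v]
    show ?thesis
      unfolding syntactic_congruence_def chain_equiv_def
    proof (intro conjI allI impI, goal_cases)
      case (3 U V U\<^sub>0 V\<^sub>0)
      then show ?case using xy[of U\<^sub>0 V\<^sub>0 U V] yx[of U\<^sub>0 V\<^sub>0 U V] ctx F by auto
    next
      case (4 U V U\<^sub>0 V\<^sub>0)
      then show ?case using xy[of U\<^sub>0 V\<^sub>0 U V] ctx by auto
    qed (rule F)+
  qed
qed

lemma saturates_syntactic_congruence: "saturates (syntactic_congruence M L) L"
  unfolding saturates_def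
proof (intro allI impI, elim conjE)
  fix x y assume cong: "syntactic_congruence M L x y" and xL: "x \<in> L"
  show "y \<in> L"
  proof (cases "x = []")
    case True
    with cong xL show ?thesis using syntactic_congruence_Nil by metis
  next
    case False
    fix \<rho>
    have "[] @ word (first x) \<in> gt_eq_words M"
      using gt_eq_words_iff[of "[hd x]" \<rho>] False by (simp add: word_first)
    moreover have "word (final x) @ [] \<in> lt_eq_words M"
      using lt_eq_words_iff[of "last x" "[]" \<rho>] False by (simp add: word_final)
    moreover have "chain_in M [] ([] @ x @ []) []"
      using chain_None[OF False] unfolding chain_in_def by (simp add: first_def final_def)
    ultimately have "[] @ [] @ x @ [] @ [] \<in> L \<longleftrightarrow> [] @ [] @ y @ [] @ [] \<in> L"
      using cong unfolding syntactic_congruence_def by blast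
    with xL show ?thesis by simp
  qed
qed

end


section \<open>Finite index and the determinised automaton\<close>

locale finite_parser = parser M psh shf mrg
  for M :: "'a::finite opm" and psh :: "'a \<Rightarrow> 'm" and shf :: "'m \<Rightarrow> 'a \<Rightarrow> 'm" and mrg :: "'m \<Rightarrow> 'm \<Rightarrow> 'm" +
  fixes C :: "'m set"
  assumes finite_C: "finite C"
    and psh_in: "psh b \<in> C"
    and shf_in: "\<rho> \<in> C \<Longrightarrow> shf \<rho> b \<in> C"
    and mrg_in: "\<rho> \<in> C \<Longrightarrow> \<rho>' \<in> C \<Longrightarrow> mrg \<rho> \<rho>' \<in> C"
begin

definition entries :: "('a option \<times> 'm) set" where
  "entries = UNIV \<times> C"

lemma finite_entries: "finite entries"
  unfolding entries_def by (intro finite_cartesian_product finite_C finite)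

lemma reduce_entries: "set \<theta> \<subseteq> entries \<Longrightarrow> set (reduce r \<theta>) \<subseteq> entries"
proof (induction r \<theta> rule: reduce.induct)
  case (1 r e d \<theta>)
  then have "(fst d, mrg (snd d) (snd e)) \<in> entries" by (auto simp: entries_def mrg_in)
  with 1 show ?case by auto
qed auto

lemma advance_entries: "set \<theta> \<subseteq> entries \<Longrightarrow> set (advance f \<theta> b) \<subseteq> entries"
proof (cases "advance f \<theta> b = []")
  case False
  assume "set \<theta> \<subseteq> entries"
  then have *: "set (reduce (Some b) \<theta>) \<subseteq> entries" by (rule reduce_entries)
  from False show ?thesis
  proof (cases rule: advance_cases)
    case (push e \<theta>')
    with * show ?thesis by (auto simp: entries_def psh_in)
  next
    case (shift e \<theta>')
    with * show ?thesis by (auto simp: entries_def intro!: shf_in)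
  qed
qed simp

lemma run_entries: "set \<theta> \<subseteq> entries \<Longrightarrow> set (run f \<theta> w) \<subseteq> entries"
  by (induction w arbitrary: \<theta>) (simp_all add: advance_entries)

text \<open>Reduced stacks on which the first letter of \<open>x\<close> is read. The bound 2 leaves
  room for the left delimiter and one open group, which that letter continues by a shift.\<close>

definition starts :: "('a option \<times> 'm) list set" where
  "starts = {\<theta>. set \<theta> \<subseteq> entries \<and> \<theta> \<noteq> [] \<and> length \<theta> \<le> 2}"

lemma finite_starts: "finite starts"
  unfolding starts_def by (rule finite_subset[OF _ finite_lists_length_le[OF finite_entries, of 2]]) auto

text \<open>\<open>e\<close> stands for what the topmost entry has become when popping reaches the
  entries below it. Only reductions to a single entry are compared, since no others occur at the end
  of a chain.\<close>

definition indist :: "('a option \<times> 'm) list \<Rightarrow> ('a option \<times> 'm) list \<Rightarrow> bool" where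
  "indist \<theta> \<theta>' \<longleftrightarrow> (\<theta> = [] \<longleftrightarrow> \<theta>' = []) \<and> (\<theta> \<noteq> [] \<longrightarrow> hd \<theta> = hd \<theta>' \<and>
     (\<forall>e\<in>entries. \<forall>r z. reduce r (e # tl \<theta>) = [z] \<longleftrightarrow> reduce r (e # tl \<theta>') = [z]))"

lemma reduce_run_indist:
  assumes \<theta>: "set \<theta> \<subseteq> entries" "2 \<le> length \<theta>" "2 \<le> length \<theta>'" and ind: "indist \<theta> \<theta>'"
    and d: "fst (hd \<theta>) = Some d" and v\<^sub>0: "d # v\<^sub>0 \<in> lt_eq_words M"
  shows "reduce r (run False \<theta> v\<^sub>0) = [z] \<longleftrightarrow> reduce r (run False \<theta>' v\<^sub>0) = [z]"
proof -
  obtain \<sigma> \<xi> where 1: "\<theta> = (Some d, \<sigma>) # \<xi>" "\<xi> \<noteq> []" using \<theta>(2) d by (cases \<theta>; cases "tl \<theta>") auto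
  with ind \<theta>(3) obtain \<xi>' where 2: "\<theta>' = (Some d, \<sigma>) # \<xi>'" "\<xi>' \<noteq> []"
    unfolding indist_def by (cases \<theta>'; cases "tl \<theta>'") auto
  \<comment> \<open>The topmost entry is parsed on its own, with the flag set because in the full
    stack it lies above others and may be shifted.\<close>
  define \<zeta> where "\<zeta> = run True [(Some d, \<sigma>)] v\<^sub>0"
  have ne: "\<zeta> \<noteq> []" unfolding \<zeta>_def using v\<^sub>0 lt_eq_words_iff by blast
  have rr: "run False \<theta> v\<^sub>0 = \<zeta> @ \<xi>" "run False \<theta>' v\<^sub>0 = \<zeta> @ \<xi>'"
    using run_frame[of True "[(Some d, \<sigma>)]" v\<^sub>0 False] ne 1 2 unfolding \<zeta>_def by auto
  have ent: "set (reduce r \<zeta>) \<subseteq> entries" unfolding \<zeta>_def using \<theta>(1) 1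
    by (intro reduce_entries run_entries) simp
  show ?thesis
  proof (cases "length (reduce r \<zeta>) = 1")
    case True
    then obtain e where e: "reduce r \<zeta> = [e]" by (auto simp: length_Suc_conv)
    then have "e \<in> entries" using ent by simp
    then have "reduce r (e # \<xi>) = [z] \<longleftrightarrow> reduce r (e # \<xi>') = [z]" using ind 1 2 unfolding indist_def by (cases z) simp
    then show ?thesis unfolding rr using reduce_append[OF ne] e by simp
  next
    case False
    then have "length (reduce r (\<zeta> @ \<xi>)) \<noteq> 1" "length (reduce r (\<zeta> @ \<xi>')) \<noteq> 1"
      using reduce_append_short[OF _ ne] 1 2 by blast+
    then show ?thesis unfolding rr by (metis One_nat_def length_Cons list.size(3))
  qed
qed

text \<open>Over the empty delimiter two entries remain after \<open>u\<^sub>0\<close> and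
  \<open>c\<close>, and over \<open>l\<close> the height is the same unless the parser fails. A push
  raises the reduced stack by one and a shift keeps its height, so it had at most two entries before
  \<open>c\<close>.\<close>

lemma gt_eq_start:
  assumes "u\<^sub>0 @ [c] \<in> gt_eq_words M" "\<rho> \<in> C"
  shows "(\<forall>x. run False [(l, \<rho>)] (u\<^sub>0 @ c # x) = []) \<or>
     (\<exists>\<theta>\<in>starts. \<forall>x. run False [(l, \<rho>)] (u\<^sub>0 @ c # x) = run False \<theta> (c # x))"
proof (cases "run False [(l, \<rho>)] (u\<^sub>0 @ [c]) = []")
  case True
  then show ?thesis by simp
next
  case False
  let ?S = "run False [(l, \<rho>)] u\<^sub>0"
  have "run False [(None, \<rho>)] (u\<^sub>0 @ [c]) \<noteq> []" by (rule run_None_nonempty) auto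
  with False obtain \<xi> \<rho>1 where "run False [(l, \<rho>)] (u\<^sub>0 @ [c]) = \<xi> @ [(l, \<rho>1)]"
    "run False [(None, \<rho>)] (u\<^sub>0 @ [c]) = \<xi> @ [(None, \<rho>1)]"
    using run_change_base[of "[]" l \<rho> "u\<^sub>0 @ [c]" None] by auto
  moreover have "length (run False [(None, \<rho>)] (u\<^sub>0 @ [c])) = 2"
    using assms(1) gt_eq_words_iff[of "u\<^sub>0 @ [c]" \<rho>] by simp
  ultimately have len: "length (advance False ?S c) = 2" by simp
  have ne: "advance False ?S c \<noteq> []" using False by simp
  have "length (reduce (Some c) ?S) \<le> 2" using ne
  proof (cases rule: advance_cases)
    case (push e \<theta>')
    with len show ?thesis by simp
  next
    case (shift e \<theta>')
    with len show ?thesis by simp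
  qed
  moreover have "?S \<noteq> []" using ne by auto
  moreover have "set (reduce (Some c) ?S) \<subseteq> entries"
    by (intro reduce_entries run_entries) (simp add: entries_def assms(2))
  ultimately have "reduce (Some c) ?S \<in> starts" unfolding starts_def by simp
  moreover have "advance False (reduce (Some c) ?S) c = advance False ?S c" by (rule advance_cong) simp
  ultimately show ?thesis by (intro disjI2 bexI[of _ "reduce (Some c) ?S"]) simp_all
qed

lemma reduce_run_indist_context:
  assumes ind: "\<forall>\<theta>\<in>starts. indist (run False \<theta> x) (run False \<theta> y)"
    and x: "x \<noteq> []" and y: "y \<noteq> []" and first: "first x = first y" and \<rho>: "\<rho> \<in> C"
    and u\<^sub>0: "u\<^sub>0 @ word (first x) \<in> gt_eq_words M" and v\<^sub>0: "word (final x) @ v\<^sub>0 \<in> lt_eq_words M"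
  shows "reduce r (run False [(l, \<rho>)] (u\<^sub>0 @ x @ v\<^sub>0)) = [z] \<longleftrightarrow> reduce r (run False [(l, \<rho>)] (u\<^sub>0 @ y @ v\<^sub>0)) = [z]"
proof -
  obtain c x' where x': "x = c # x'" using x by (cases x) auto
  with y first obtain y' where y': "y = c # y'" by (cases y) (auto simp: first_def)
  have "u\<^sub>0 @ [c] \<in> gt_eq_words M" using u\<^sub>0 x' by (simp add: first_def)
  from gt_eq_start[OF this \<rho>, of l] show ?thesis
  proof
    assume "\<forall>x. run False [(l, \<rho>)] (u\<^sub>0 @ c # x) = []"
    then have "run False [(l, \<rho>)] (u\<^sub>0 @ x @ v\<^sub>0) = []" "run False [(l, \<rho>)] (u\<^sub>0 @ y @ v\<^sub>0) = []"
      unfolding x' y' append_Cons by blast+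
    then show ?thesis by simp
  next
    assume "\<exists>\<theta>\<in>starts. \<forall>x. run False [(l, \<rho>)] (u\<^sub>0 @ c # x) = run False \<theta> (c # x)"
    then obtain \<theta> where \<theta>: "\<theta> \<in> starts" "run False [(l, \<rho>)] (u\<^sub>0 @ c # w) = run False \<theta> (c # w)" for w by blast
    have eq: "run False [(l, \<rho>)] (u\<^sub>0 @ x @ v\<^sub>0) = run False (run False \<theta> x) v\<^sub>0"
      "run False [(l, \<rho>)] (u\<^sub>0 @ y @ v\<^sub>0) = run False (run False \<theta> y) v\<^sub>0"
      using \<theta>(2)[of "x' @ v\<^sub>0"] \<theta>(2)[of "y' @ v\<^sub>0"] unfolding x' y' by simp_all
    have I: "indist (run False \<theta> x) (run False \<theta> y)" using ind \<theta>(1) by blast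
    show ?thesis
    proof (cases "run False \<theta> x = []")
      case True
      with I show ?thesis unfolding eq indist_def by simp
    next
      case False
      with I have F: "run False \<theta> y \<noteq> []" unfolding indist_def by simp
      show ?thesis unfolding eq
      proof (rule reduce_run_indist[OF _ _ _ I])
        show "set (run False \<theta> x) \<subseteq> entries" using \<theta>(1) by (intro run_entries) (simp add: starts_def)
        show "2 \<le> length (run False \<theta> x)" "2 \<le> length (run False \<theta> y)" using length_run False F x y by blast+
        show "fst (hd (run False \<theta> x)) = Some (last x)" using fst_hd_run[OF False x] x by (simp add: final_def)
        show "last x # v\<^sub>0 \<in> lt_eq_words M" using v\<^sub>0 x by (simp add: final_def)
      qed
    qed
  qed
qed

text \<open>\<open>P\<close> stands for acceptance, read off the stack at the end of the input. In
  every admissible context \<open>x\<close> and \<open>y\<close> reduce to the same entry, payload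
  included, so from \<open>v\<close> on the runs coincide.\<close>

theorem indist_syntactic_congruence:
  assumes ind: "\<forall>\<theta>\<in>starts. indist (run False \<theta> x) (run False \<theta> y)"
    and x: "x \<noteq> []" and y: "y \<noteq> []" and first: "first x = first y"
    and \<rho>\<^sub>0: "\<rho>\<^sub>0 \<in> C" and L: "\<And>w. w \<in> L \<longleftrightarrow> P (reduce None (run False [(None, \<rho>\<^sub>0)] w))"
  shows "syntactic_congruence M L x y"
  unfolding syntactic_congruence_def chain_equiv_def
proof (intro conjI allI impI)
  note ctx = reduce_run_indist_context[OF ind x y first]
  have ch: "chain_in M u (u\<^sub>0 @ w @ v\<^sub>0) v \<longleftrightarrow> (\<exists>z. reduce (first v) (run False [(final u, \<rho>\<^sub>0)] (u\<^sub>0 @ w @ v\<^sub>0)) = [z])"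
    if "w \<noteq> []" for u v u\<^sub>0 v\<^sub>0 w
    using that chain_iff[of "final u" "u\<^sub>0 @ w @ v\<^sub>0" "first v" \<rho>\<^sub>0] unfolding chain_in_def
    by (simp add: length_Suc_conv)
  {
    have "run False [(None, \<rho>\<^sub>0)] x \<noteq> []" "run False [(None, \<rho>\<^sub>0)] y \<noteq> []"
      by (rule run_None_nonempty; simp)+
    moreover have "[(None, \<rho>\<^sub>0)] \<in> starts" using \<rho>\<^sub>0 by (simp add: starts_def entries_def)
    ultimately show "final x = final y" using ind fst_hd_run[of False _ x] fst_hd_run[of False _ y] x y
      unfolding indist_def by metis
  next
    fix u v u\<^sub>0 v\<^sub>0
    assume "u\<^sub>0 @ word (first x) \<in> gt_eq_words M \<and> word (final x) @ v\<^sub>0 \<in> lt_eq_words M"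
    then show "chain_in M u (u\<^sub>0 @ x @ v\<^sub>0) v \<longleftrightarrow> chain_in M u (u\<^sub>0 @ y @ v\<^sub>0) v"
      using ctx[OF \<rho>\<^sub>0] unfolding ch[OF x] ch[OF y] by blast
  next
    fix u v u\<^sub>0 v\<^sub>0
    assume *: "u\<^sub>0 @ word (first x) \<in> gt_eq_words M \<and> word (final x) @ v\<^sub>0 \<in> lt_eq_words M \<and>
      chain_in M u (u\<^sub>0 @ x @ v\<^sub>0) v"
    let ?S = "run False [(None, \<rho>\<^sub>0)] u"
    have ne: "?S \<noteq> []" by (rule run_None_nonempty) auto
    have "fst (hd ?S) = final u" using fst_hd_run[OF ne] by (cases "u = []") (auto simp: final_def)
    then obtain \<sigma> \<theta> where S: "?S = (final u, \<sigma>) # \<theta>" using ne by (cases ?S) auto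
    have "set ?S \<subseteq> entries" using \<rho>\<^sub>0 by (intro run_entries) (simp add: entries_def)
    then have \<sigma>: "\<sigma> \<in> C" unfolding S by (simp add: entries_def)
    have "length (reduce (first v) (run False [(final u, \<sigma>)] (u\<^sub>0 @ x @ v\<^sub>0))) = 1"
      using * chain_iff[of _ _ _ \<sigma>] unfolding chain_in_def by blast
    then obtain z where z: "reduce (first v) (run False [(final u, \<sigma>)] (u\<^sub>0 @ x @ v\<^sub>0)) = [z]"
      by (auto simp: length_Suc_conv)
    then have z': "reduce (first v) (run False [(final u, \<sigma>)] (u\<^sub>0 @ y @ v\<^sub>0)) = [z]"
      using ctx[OF \<sigma>] * by blast
    \<comment> \<open>The chain is parsed over the top entry of \<open>u\<close> alone; the
      remaining entries \<theta> are framed underneath.\<close>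
    have red: "reduce (first v) (run False ?S w) = reduce (first v) (z # \<theta>)"
      if "reduce (first v) (run False [(final u, \<sigma>)] w) = [z]" for w
    proof -
      have ne: "run False [(final u, \<sigma>)] w \<noteq> []" using that by auto
      from run_frame[OF ne, of False \<theta>] reduce_append[OF ne, of "first v" \<theta>] that show ?thesis unfolding S by simp
    qed
    from red[OF z] red[OF z'] have "reduce None (run False (run False ?S (u\<^sub>0 @ x @ v\<^sub>0)) v) = reduce None (run False (run False ?S (u\<^sub>0 @ y @ v\<^sub>0)) v)"
      by (intro reduce_run_cong) simp
    then show "u @ u\<^sub>0 @ x @ v\<^sub>0 @ v \<in> L \<longleftrightarrow> u @ u\<^sub>0 @ y @ v\<^sub>0 @ v \<in> L" unfolding L by simp
  }
qed (rule first)

end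


section \<open>Simulation of the automaton by relations on its states\<close>

locale automaton =
  fixes M :: "'a::finite opm" and A :: "('a, 'q) opa"
  assumes opa: "opa A"
begin

text \<open>
  The relation of a stack entry leads from the state in which its group was pushed to the state in
  which the group above it was pushed, or to the current state for the topmost entry.
\<close>

definition push_rel :: "'a \<Rightarrow> ('q \<times> 'q) set" where
  "push_rel b = {(p, s). (p, b, s) \<in> push_trans A}"

definition shift_rel :: "('q \<times> 'q) set \<Rightarrow> 'a \<Rightarrow> ('q \<times> 'q) set" where
  "shift_rel \<rho> b = \<rho> O {(s, t). (s, b, t) \<in> shift_trans A}"

text \<open>The state \<open>p\<close> in which the popped group was pushed is also the end point of
  a path in the relation below. A pop from \<open>s\<close> with stacked state \<open>p\<close>
  therefore extends that path to \<open>t\<close>.\<close>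

definition pop_rel :: "('q \<times> 'q) set \<Rightarrow> ('q \<times> 'q) set \<Rightarrow> ('q \<times> 'q) set" where
  "pop_rel \<rho>' \<rho> = \<rho>' O {(p, t). \<exists>s. (p, s) \<in> \<rho> \<and> (s, p, t) \<in> pop_trans A}"

sublocale finite_parser M push_rel shift_rel pop_rel "Pow (states A \<times> states A)"
  by unfold_locales (use opa in \<open>auto simp: opa_def push_rel_def shift_rel_def pop_rel_def\<close>)

text \<open>A configuration that the relations allow: each stacked state \<open>p\<close> ends a
  step of the relation below and starts a step of its own. The base starts in
  \<open>q\<^sub>0\<close>, and the topmost step ends in the current state.\<close>

inductive compatible :: "'q \<Rightarrow> ('a option \<times> ('q \<times> 'q) set) list \<Rightarrow> 'q \<Rightarrow> ('a \<times> 'q) list \<Rightarrow> bool" for q\<^sub>0 where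
  base: "(q\<^sub>0, s) \<in> \<rho> \<Longrightarrow> compatible q\<^sub>0 [(None, \<rho>)] s []"
| entry: "compatible q\<^sub>0 \<theta> p \<kappa> \<Longrightarrow> (p, s) \<in> \<rho> \<Longrightarrow> compatible q\<^sub>0 ((Some a, \<rho>) # \<theta>) s ((a, p) # \<kappa>)"

inductive_cases compatible_Cons: "compatible q\<^sub>0 (e # \<theta>) s \<kappa>"
inductive_cases compatible_Some: "compatible q\<^sub>0 ((Some a, \<rho>) # \<theta>) s \<kappa>"
inductive_cases compatible_None: "compatible q\<^sub>0 ((None, \<rho>) # \<theta>) s \<kappa>"
inductive_cases compatible_Nil: "compatible q\<^sub>0 [] s \<kappa>"

definition accepts :: "'q \<Rightarrow> 'a list \<Rightarrow> ('a \<times> 'q) list \<Rightarrow> bool" where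
  "accepts s w \<kappa> \<longleftrightarrow> (\<exists>q\<in>accepting A. (opa_step M A)\<^sup>*\<^sup>* (s, w, \<kappa>) (q, [], []))"

text \<open>The invariant looks at the future: each parser step preserves whether some compatible
  configuration accepts the remaining input, so the simulation proceeds by equivalences.\<close>

definition accepts_some :: "'q \<Rightarrow> ('a option \<times> ('q \<times> 'q) set) list \<Rightarrow> 'a list \<Rightarrow> bool" where
  "accepts_some q\<^sub>0 \<theta> w \<longleftrightarrow> (\<exists>s \<kappa>. compatible q\<^sub>0 \<theta> s \<kappa> \<and> accepts s w \<kappa>)"

lemma accepts_step: "opa_step M A (s, w, \<kappa>) (s', w', \<kappa>') \<Longrightarrow> accepts s' w' \<kappa>' \<Longrightarrow> accepts s w \<kappa>"
  unfolding accepts_def by (meson converse_rtranclp_into_rtranclp)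

lemma accepts_cases:
  assumes "accepts s w \<kappa>"
  obtains (final) "w = []" "\<kappa> = []" "s \<in> accepting A"
  | (step) s' w' \<kappa>' where "opa_step M A (s, w, \<kappa>) (s', w', \<kappa>')" "accepts s' w' \<kappa>'"
  using assms unfolding accepts_def by (metis converse_rtranclpE prod.inject surj_pair)

text \<open>Exactly one precedence relation holds between the top letter and the lookahead, so the
  kind of the next move is forced and only its target state is free. The same reason applies to push
  and shift.\<close>

lemma accepts_pop:
  assumes "eprec M (Some a) (first w) = Gt"
  shows "accepts s w ((a, p) # \<kappa>) \<longleftrightarrow> (\<exists>t. (s, p, t) \<in> pop_trans A \<and> accepts t w \<kappa>)"
proof
  assume "accepts s w ((a, p) # \<kappa>)"
  then show "\<exists>t. (s, p, t) \<in> pop_trans A \<and> accepts t w \<kappa>"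
  proof (cases rule: accepts_cases)
    case (step s' w' \<kappa>')
    from step(1) show ?thesis using step(2) assms
      by cases (auto simp: first_def)
  qed simp
qed (use assms in \<open>auto intro: accepts_step opa_step.pop\<close>)

lemma accepts_push:
  assumes "\<kappa> = [] \<or> M (fst (hd \<kappa>)) b = Lt"
  shows "accepts s (b # w) \<kappa> \<longleftrightarrow> (\<exists>t. (s, b, t) \<in> push_trans A \<and> accepts t w ((b, s) # \<kappa>))"
proof
  assume "accepts s (b # w) \<kappa>"
  then show "\<exists>t. (s, b, t) \<in> push_trans A \<and> accepts t w ((b, s) # \<kappa>)"
  proof (cases rule: accepts_cases)
    case (step s' w' \<kappa>')
    from step(1) show ?thesis using step(2) assms
      by cases (auto simp: first_def)
  qed simp
qed (use assms in \<open>auto intro: accepts_step opa_step.push\<close>)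

lemma accepts_shift:
  assumes "M a b = Eq"
  shows "accepts s (b # w) ((a, p) # \<kappa>) \<longleftrightarrow> (\<exists>t. (s, b, t) \<in> shift_trans A \<and> accepts t w ((b, p) # \<kappa>))"
proof
  assume "accepts s (b # w) ((a, p) # \<kappa>)"
  then show "\<exists>t. (s, b, t) \<in> shift_trans A \<and> accepts t w ((b, p) # \<kappa>)"
  proof (cases rule: accepts_cases)
    case (step s' w' \<kappa>')
    from step(1) show ?thesis using step(2) assms
      by cases (auto simp: first_def)
  qed simp
qed (use assms in \<open>auto intro: accepts_step opa_step.shift\<close>)

lemma accepts_empty: "accepts s [] [] \<longleftrightarrow> s \<in> accepting A"
proof
  assume "accepts s [] []"
  then show "s \<in> accepting A"
    by (cases rule: accepts_cases) (auto elim: opa_step.cases)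
qed (auto simp: accepts_def)

lemma compatible_pop:
  "compatible q\<^sub>0 ((l, pop_rel \<rho>' \<rho>) # \<theta>) t \<kappa> \<longleftrightarrow>
     (\<exists>p s. compatible q\<^sub>0 ((l, \<rho>') # \<theta>) p \<kappa> \<and> (p, s) \<in> \<rho> \<and> (s, p, t) \<in> pop_trans A)"
proof (cases l)
  case None
  then show ?thesis
    by (auto simp: pop_rel_def elim!: compatible_None intro: compatible.base)
next
  case (Some a)
  then show ?thesis
    by (fastforce simp: pop_rel_def elim!: compatible_Some intro: compatible.entry)
qed

lemma accepts_some_reduce: "accepts_some q\<^sub>0 (reduce (first w) \<theta>) w \<longleftrightarrow> accepts_some q\<^sub>0 \<theta> w"
proof (induction "first w" \<theta> rule: reduce.induct)
  case (1 e d \<theta>)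
  show ?case
  proof (cases "eprec M (fst e) (first w) = Gt")
    case True
    then obtain a where a: "fst e = Some a" by (cases "fst e"; cases "first w") auto
    have "accepts_some q\<^sub>0 (e # d # \<theta>) w \<longleftrightarrow>
      (\<exists>p s \<kappa>. compatible q\<^sub>0 (d # \<theta>) p \<kappa> \<and> (p, s) \<in> snd e \<and> accepts s w ((a, p) # \<kappa>))"
      unfolding accepts_some_def using a
      by (cases e) (fastforce elim!: compatible_Some intro: compatible.entry)
    also have "\<dots> \<longleftrightarrow> (\<exists>t \<kappa>. compatible q\<^sub>0 ((fst d, pop_rel (snd d) (snd e)) # \<theta>) t \<kappa> \<and> accepts t w \<kappa>)"
      unfolding compatible_pop using True a by (auto simp: accepts_pop; blast)
    finally show ?thesis using 1 True by (simp add: accepts_some_def)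
  qed simp
qed auto

lemma accepts_some_advance: "accepts_some q\<^sub>0 \<theta> (b # w) \<longleftrightarrow> accepts_some q\<^sub>0 (advance False \<theta> b) w"
proof -
  have "accepts_some q\<^sub>0 \<theta> (b # w) \<longleftrightarrow> accepts_some q\<^sub>0 (reduce (Some b) \<theta>) (b # w)"
    using accepts_some_reduce[of q\<^sub>0 "b # w" \<theta>] by (simp add: first_def)
  also have "\<dots> \<longleftrightarrow> accepts_some q\<^sub>0 (advance False (reduce (Some b) \<theta>) b) w"
  proof (cases "reduce (Some b) \<theta>")
    case Nil
    then show ?thesis by (auto simp: accepts_some_def elim: compatible_Nil)
  next
    case (Cons e \<theta>')
    show ?thesis
    proof (cases "eprec M (fst e) (Some b)")
      case Lt
      have "compatible q\<^sub>0 (e # \<theta>') s \<kappa> \<Longrightarrow> \<kappa> = [] \<or> M (fst (hd \<kappa>)) b = Lt" for s \<kappa>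
        using Lt by (auto elim: compatible_Cons)
      then have "accepts_some q\<^sub>0 (e # \<theta>') (b # w) \<longleftrightarrow>
         (\<exists>s \<kappa> t. compatible q\<^sub>0 (e # \<theta>') s \<kappa> \<and> (s, b, t) \<in> push_trans A \<and> accepts t w ((b, s) # \<kappa>))"
        unfolding accepts_some_def using accepts_push by blast
      also have "\<dots> \<longleftrightarrow> accepts_some q\<^sub>0 ((Some b, push_rel b) # e # \<theta>') w"
        unfolding accepts_some_def
        by (fastforce simp: push_rel_def elim!: compatible_Some intro: compatible.entry)
      finally show ?thesis using Lt Cons by simp
    next
      case Eq
      then obtain a \<rho> where e: "e = (Some a, \<rho>)" "M a b = Eq" by (cases e; cases "fst e") auto
      show ?thesis
      proof (cases "\<theta>' = []")
        case True
        \<comment> \<open>Compatible configurations have the empty delimiter as base, so none exists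
          for a bare base carrying a letter, and failure of the parser loses nothing.\<close>
        have "\<not> compatible q\<^sub>0 [e] s \<kappa>" for s \<kappa>
          using e by (auto elim!: compatible_Some elim: compatible_Nil)
        with True Eq Cons show ?thesis by (auto simp: accepts_some_def advance_def elim: compatible_Nil)
      next
        case False
        have "accepts_some q\<^sub>0 (e # \<theta>') (b # w) \<longleftrightarrow>
          (\<exists>s p \<kappa> t. compatible q\<^sub>0 \<theta>' p \<kappa> \<and> (p, s) \<in> \<rho> \<and> (s, b, t) \<in> shift_trans A \<and> accepts t w ((b, p) # \<kappa>))"
          unfolding accepts_some_def e(1)
          by (fastforce simp: accepts_shift[OF e(2)] elim!: compatible_Some intro: compatible.entry)
        also have "\<dots> \<longleftrightarrow> accepts_some q\<^sub>0 ((Some b, shift_rel \<rho> b) # \<theta>') w"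
          unfolding accepts_some_def
          by (fastforce simp: shift_rel_def elim!: compatible_Some intro: compatible.entry)
        finally show ?thesis using Eq False Cons e by simp
      qed
    next
      case Gt
      \<comment> \<open>A reduced stack shows \<open>Gt\<close> to its lookahead only at a bare
        base.\<close>
      then have "\<theta>' = []" using Cons by (cases \<theta>') (auto dest: reduce_stop)
      moreover have "\<not> compatible q\<^sub>0 [e] s \<kappa>" for s \<kappa>
        using Gt by (auto elim!: compatible_Cons elim: compatible_Nil)
      ultimately show ?thesis using Gt Cons by (auto simp: accepts_some_def elim: compatible_Nil)
    qed
  qed
  also have "advance False (reduce (Some b) \<theta>) b = advance False \<theta> b" by (rule advance_cong) simp
  finally show ?thesis .
qed

lemma accepts_some_run: "accepts_some q\<^sub>0 \<theta> (v @ w) \<longleftrightarrow> accepts_some q\<^sub>0 (run False \<theta> v) w"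
  by (induction v arbitrary: \<theta>) (simp_all add: accepts_some_advance)

text \<open>The relation of the base pairs a first state with the current one. It starts as the
  identity, which handles all initial states at once, and at the end it contains the pairs joined by
  runs on \<open>w\<close>.\<close>

theorem opa_language_iff:
  "w \<in> opa_language M A \<longleftrightarrow>
     snd (hd (reduce None (run False [(None, Id_on (states A))] w))) \<inter> initial A \<times> accepting A \<noteq> {}"
proof -
  let ?R = "reduce None (run False [(None, Id_on (states A))] w)"
  have "length ?R = 1" by (rule length_reduce_run_None)
  then obtain e where e: "?R = [e]" by (auto simp: length_Suc_conv)
  have ne: "run False [(None, Id_on (states A))] w \<noteq> []" by (rule run_None_nonempty) auto
  then have "fst e = None"
    using fst_last_reduce[OF ne, of None] fst_last_run[OF ne] e by simp
  then obtain \<rho> where \<rho>: "?R = [(None, \<rho>)]" using e by (cases e) auto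
  have "w \<in> opa_language M A \<longleftrightarrow> (\<exists>q\<^sub>0\<in>initial A. accepts q\<^sub>0 w [])"
    unfolding opa_language_def accepts_def by simp
  also have "\<dots> \<longleftrightarrow> (\<exists>q\<^sub>0\<in>initial A. accepts_some q\<^sub>0 [(None, Id_on (states A))] w)"
    using opa unfolding accepts_some_def opa_def
    by (blast elim: compatible_None intro: compatible.base)
  also have "\<dots> \<longleftrightarrow> (\<exists>q\<^sub>0\<in>initial A. accepts_some q\<^sub>0 ?R [])"
    using accepts_some_run[of _ _ w "[]"] accepts_some_reduce[of _ "[]"] by (simp add: first_def)
  also have "\<dots> \<longleftrightarrow> (\<exists>q\<^sub>0\<in>initial A. \<exists>q\<in>accepting A. (q\<^sub>0, q) \<in> \<rho>)"
    unfolding \<rho> accepts_some_def using accepts_empty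
    by (blast elim: compatible_None intro: compatible.base)
  finally show ?thesis unfolding \<rho> by auto
qed

end


section \<open>Computing the invariants\<close>

text \<open>Equal invariants imply \<open>R\<close>, so \<open>R\<close> depends on two values from
  a finite set. The table of this dependence is finite and hence computable, and one representative
  for each value gives the finite basis.\<close>

lemma equiv_finite_invariants:
  fixes R :: "'a::finite list \<Rightarrow> 'a list \<Rightarrow> bool"
  assumes "finite \<Phi>"
    and "\<And>\<phi>. \<phi> \<in> \<Phi> \<Longrightarrow> computable 2 (\<lambda>xs. \<phi> (xs ! 0)) \<and> computable 2 (\<lambda>xs. \<phi> (xs ! 1))"
    and "\<And>\<phi>. \<phi> \<in> \<Phi> \<Longrightarrow> finite (range (\<lambda>w :: 'a list. \<phi> (code_word w)))"
    and "\<And>x y. \<forall>\<phi>\<in>\<Phi>. \<phi> (code_word x) = \<phi> (code_word y) \<Longrightarrow> R x y"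
    and "reflp R" "symp R" "transp R"
  shows "decidable R" "well_quasi_order R"
proof -
  \<comment> \<open>Pairing combines the finitely many invariants into a single one with the same
    properties.\<close>
  have "\<exists>\<psi>. (computable 2 (\<lambda>xs. \<psi> (xs ! 0)) \<and> computable 2 (\<lambda>xs. \<psi> (xs ! 1))) \<and>
      finite (range (\<lambda>w :: 'a list. \<psi> (code_word w))) \<and>
      (\<forall>m n. \<psi> m = \<psi> n \<longrightarrow> (\<forall>\<phi>\<in>\<Phi>. \<phi> m = \<phi> n))"
    using assms(1-3)
  proof (induction \<Phi> rule: finite_induct)
    case empty
    show ?case by (intro exI[of _ "\<lambda>_. 0"]) (auto intro: computable_const)
  next
    case (insert \<phi> \<Phi>)
    then obtain \<psi> where \<psi>: "computable 2 (\<lambda>xs. \<psi> (xs ! 0))" "computable 2 (\<lambda>xs. \<psi> (xs ! 1))"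
      "finite (range (\<lambda>w :: 'a list. \<psi> (code_word w)))" "\<forall>m n. \<psi> m = \<psi> n \<longrightarrow> (\<forall>\<phi>\<in>\<Phi>. \<phi> m = \<phi> n)"
      using insert.IH[OF insert.prems(1)[OF insertI2] insert.prems(2)[OF insertI2]] by blast
    have \<phi>: "computable 2 (\<lambda>xs. \<phi> (xs ! 0))" "computable 2 (\<lambda>xs. \<phi> (xs ! 1))"
      "finite (range (\<lambda>w :: 'a list. \<phi> (code_word w)))"
      using insert.prems by simp_all
    have "range (\<lambda>w :: 'a list. prod_encode (\<phi> (code_word w), \<psi> (code_word w)))
      \<subseteq> prod_encode ` (range (\<lambda>w :: 'a list. \<phi> (code_word w)) \<times> range (\<lambda>w :: 'a list. \<psi> (code_word w)))"
      by blast
    then have "finite (range (\<lambda>w :: 'a list. prod_encode (\<phi> (code_word w), \<psi> (code_word w))))"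
      by (rule finite_subset) (intro finite_imageI finite_cartesian_product \<phi> \<psi>)
    with \<phi> \<psi> show ?case
      by (intro exI[of _ "\<lambda>n. prod_encode (\<phi> n, \<psi> n)"]) (auto intro!: computable_prod_encode)
  qed
  then obtain \<psi> where comp: "computable 2 (\<lambda>xs. \<psi> (xs ! 0))" "computable 2 (\<lambda>xs. \<psi> (xs ! 1))"
    and fin: "finite (range (\<lambda>w :: 'a list. \<psi> (code_word w)))"
    and "\<forall>m n. \<psi> m = \<psi> n \<longrightarrow> (\<forall>\<phi>\<in>\<Phi>. \<phi> m = \<phi> n)" by blast
  then have \<psi>: "R x y" if "\<psi> (code_word x) = \<psi> (code_word y)" for x y using that assms(4) by blast
  \<comment> \<open>The table is read off \<open>R\<close> itself. Decidability asks only that a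
    recursive function exists, so nothing has to be computed here.\<close>
  define h :: "nat \<Rightarrow> nat \<Rightarrow> nat" where
    "h i j = (if \<exists>x y. \<psi> (code_word x) = i \<and> \<psi> (code_word y) = j \<and> R x y then 1 else 0)" for i j
  have "{(i, j). h i j \<noteq> 0} \<subseteq> range (\<lambda>w :: 'a list. \<psi> (code_word w)) \<times> range (\<lambda>w :: 'a list. \<psi> (code_word w))"
    by (auto simp: h_def split: if_splits)
  then have "finite {(i, j). h i j \<noteq> 0}"
    by (rule finite_subset) (intro finite_cartesian_product fin)
  from computable_table2[OF this comp] obtain f
    where f: "\<And>xs. length xs = 2 \<Longrightarrow> rec_eval f xs (h (\<psi> (xs ! 0)) (\<psi> (xs ! 1)))"
    unfolding computable_def by blast
  have "h (\<psi> (code_word x)) (\<psi> (code_word y)) = (if R x y then 1 else 0)" for x y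
  proof -
    have "R x y" if "\<psi> (code_word x') = \<psi> (code_word x)" "\<psi> (code_word y') = \<psi> (code_word y)" "R x' y'" for x' y'
      using \<psi>[OF that(1)] \<psi>[OF that(2)] that(3) assms(6,7) by (meson sympD transpD)
    then show ?thesis unfolding h_def by auto
  qed
  then have "rec_eval f [code_word x, code_word y] (if R x y then 1 else 0)" for x y
    using f[of "[code_word x, code_word y]"] by simp
  then show "decidable R" unfolding decidable_def by blast
  have "\<exists>X. finite X \<and> X \<subseteq> Y \<and> (\<forall>y\<in>Y. \<exists>x\<in>X. R x y)" for Y
  proof -
    let ?k = "\<lambda>w :: 'a list. \<psi> (code_word w)"
    \<comment> \<open>One element of \<open>Y\<close> for each value that the invariant takes on
      \<open>Y\<close>.\<close>
    let ?X = "inv_into Y ?k ` (?k ` Y)"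
    have "finite ?X" by (rule finite_imageI) (rule finite_subset[OF _ fin], blast)
    moreover have "?X \<subseteq> Y" by (auto intro: inv_into_into)
    moreover have "\<exists>x\<in>?X. R x y" if "y \<in> Y" for y
    proof
      show "R (inv_into Y ?k (?k y)) y" using that by (intro \<psi> f_inv_into_f) (rule imageI)
      show "inv_into Y ?k (?k y) \<in> ?X" using that by (intro imageI)
    qed
    ultimately show ?thesis by blast
  qed
  then show "well_quasi_order R" using assms(5,7) unfolding well_quasi_order_def by blast
qed

text \<open>0 is reserved for the end of the input, so a letter found in \<open>code_word\<close>
  becomes a lookahead only after a successor.\<close>

fun letter_code :: "'a::finite option \<Rightarrow> nat" where
  "letter_code None = 0"
| "letter_code (Some a) = Suc (to_nat a)"

lemma inj_letter_code: "inj letter_code"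
proof (rule injI)
  fix a b :: "'a option" assume "letter_code a = letter_code b"
  then show "a = b" by (cases a; cases b) auto
qed

lemma inv_letter_code [simp]: "inv letter_code (letter_code a) = a"
  by (rule inv_f_f[OF inj_letter_code])

section \<open>The parser on codes of stacks and words\<close>

context finite_parser begin

text \<open>Codes of entries are positive, since \<open>head_code\<close> and \<open>tail_code\<close> return 0 on the empty list.\<close>

definition enc :: "'a option \<times> 'm \<Rightarrow> nat" where
  "enc e = Suc ((SOME f. inj_on f entries) e)"

lemma inj_enc: "inj_on enc entries"
proof -
  have "\<exists>f :: _ \<Rightarrow> nat. inj_on f entries"
    using finite_imp_inj_to_nat_seg[OF finite_entries] by blast
  from someI_ex[OF this] show ?thesis unfolding enc_def inj_on_def by simp
qed

lemma enc_pos [simp]: "enc e \<noteq> 0" "0 < enc e"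
  by (simp_all add: enc_def)

definition dec :: "nat \<Rightarrow> 'a option \<times> 'm" where
  "dec = inv_into entries enc"

lemma dec_enc [simp]: "e \<in> entries \<Longrightarrow> dec (enc e) = e"
  unfolding dec_def by (rule inv_into_f_f[OF inj_enc])

text \<open>0 says that the move does not apply, which is unambiguous as codes of entries are
  positive. The range conditions keep the support finite, since \<open>dec\<close> and
  \<open>inv\<close> are arbitrary elsewhere.\<close>

definition pop_table :: "nat \<Rightarrow> nat \<Rightarrow> nat \<Rightarrow> nat" where
  "pop_table i j k = (if i \<in> enc ` entries \<and> j \<in> enc ` entries \<and> k \<in> range (letter_code :: 'a option \<Rightarrow> nat) \<and>
       eprec M (fst (dec i)) (inv letter_code k) = Gt
     then enc (fst (dec j), mrg (snd (dec j)) (snd (dec i))) else 0)"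

definition push_table :: "nat \<Rightarrow> nat \<Rightarrow> nat" where
  "push_table i k = (if i \<in> enc ` entries \<and> k \<in> range (letter_code :: 'a option \<Rightarrow> nat) \<and>
       eprec M (fst (dec i)) (inv letter_code k) = Lt
     then enc (inv letter_code k, psh (the (inv letter_code k))) else 0)"

definition shift_table :: "nat \<Rightarrow> nat \<Rightarrow> nat" where
  "shift_table i k = (if i \<in> enc ` entries \<and> k \<in> range (letter_code :: 'a option \<Rightarrow> nat) \<and>
       eprec M (fst (dec i)) (inv letter_code k) = Eq
     then enc (inv letter_code k, shf (snd (dec i)) (the (inv letter_code k))) else 0)"

lemma finite_tables:
  "finite {(i, j, k). pop_table i j k \<noteq> 0}" "finite {(i, k). push_table i k \<noteq> 0}"
  "finite {(i, k). shift_table i k \<noteq> 0}"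
proof -
  have "finite (enc ` entries)" "finite (range (letter_code :: 'a option \<Rightarrow> nat))"
    using finite_entries by auto
  note fin = finite_cartesian_product[OF this] finite_cartesian_product[OF this(1) finite_cartesian_product[OF this]]
  show "finite {(i, j, k). pop_table i j k \<noteq> 0}"
    by (rule finite_subset[OF _ fin(2)]) (auto simp: pop_table_def split: if_splits)
  show "finite {(i, k). push_table i k \<noteq> 0}"
    by (rule finite_subset[OF _ fin(1)]) (auto simp: push_table_def split: if_splits)
  show "finite {(i, k). shift_table i k \<noteq> 0}"
    by (rule finite_subset[OF _ fin(1)]) (auto simp: shift_table_def split: if_splits)
qed

definition reduce_step_code :: "nat \<Rightarrow> nat \<Rightarrow> nat" where
  "reduce_step_code k s = (if pop_table (head_code s) (head_code (tail_code s)) k = 0 then s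
     else cons_code (pop_table (head_code s) (head_code (tail_code s)) k) (tail_code (tail_code s)))"

text \<open>The code of a stack is at least its height, so \<open>s\<close> rounds of popping
  suffice; surplus rounds are idle.\<close>

definition reduce_code :: "nat \<Rightarrow> nat \<Rightarrow> nat" where
  "reduce_code k s = (reduce_step_code k ^^ s) s"

definition advance_code :: "nat \<Rightarrow> nat \<Rightarrow> nat" where
  "advance_code k s =
     (if push_table (head_code (reduce_code k s)) k = 0 then
        if tail_code (reduce_code k s) = 0 then 0
        else if shift_table (head_code (reduce_code k s)) k = 0 then 0
        else cons_code (shift_table (head_code (reduce_code k s)) k) (tail_code (reduce_code k s))
      else cons_code (push_table (head_code (reduce_code k s)) k) (reduce_code k s))"

text \<open>The code of a word is at least its length and so bounds the number of rounds. Round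
  \<open>m\<close> fetches its letter by \<open>m\<close> tails and is idle once the word is
  exhausted.\<close>

definition run_code :: "nat \<Rightarrow> nat \<Rightarrow> nat" where
  "run_code s w = rec_nat s (\<lambda>m t. if (tail_code ^^ m) w = 0 then t
     else advance_code (Suc (head_code ((tail_code ^^ m) w))) t) w"

lemma computable_reduce_step_code:
  "computable n K \<Longrightarrow> computable n S \<Longrightarrow> computable n (\<lambda>xs. reduce_step_code (K xs) (S xs))"
  unfolding reduce_step_code_def
  by (intro computable_if computable_cons_code computable_table3[OF finite_tables(1)]
      computable_head_code computable_tail_code)

lemma computable_reduce_code:
  assumes "computable n K" "computable n S"
  shows "computable n (\<lambda>xs. reduce_code (K xs) (S xs))"
  unfolding reduce_code_def
  by (rule computable_funpow[of n "\<lambda>s xs. reduce_step_code (K xs) s"])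
    (intro computable_reduce_step_code computable_drop2 computable_nth assms; simp)+

lemma computable_advance_code:
  "computable n K \<Longrightarrow> computable n S \<Longrightarrow> computable n (\<lambda>xs. advance_code (K xs) (S xs))"
  unfolding advance_code_def
  by (intro computable_if computable_cons_code computable_table2[OF finite_tables(2)]
      computable_table2[OF finite_tables(3)] computable_reduce_code
      computable_head_code computable_tail_code computable_const)

lemma computable_run_code:
  assumes "computable n S" "computable n W"
  shows "computable n (\<lambda>xs. run_code (S xs) (W xs))"
proof -
  let ?T = "\<lambda>ys :: nat list. (tail_code ^^ (ys ! 0)) (W (drop 2 ys))"
  have T: "computable (Suc (Suc n)) ?T"
    by (rule computable_funpow[of _ "\<lambda>s xs. tail_code s"])
      (intro computable_tail_code computable_drop2 computable_nth assms; simp)+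
  have "computable (Suc (Suc n)) (\<lambda>ys. if ?T ys = 0 then ys ! 1
     else advance_code (Suc (head_code (?T ys))) (ys ! 1))"
    by (intro computable_if computable_advance_code computable_Suc computable_head_code T computable_nth) simp_all
  from computable_rec_nat[OF assms(1) this assms(2)] show ?thesis
    unfolding run_code_def .
qed

definition stack_code :: "('a option \<times> 'm) list \<Rightarrow> nat" where
  "stack_code \<theta> = list_encode (map enc \<theta>)"

lemma stack_code_simps [simp]:
  "stack_code [] = 0" "stack_code (e # \<theta>) = cons_code (enc e) (stack_code \<theta>)"
  by (simp_all add: stack_code_def)

lemma stack_code_eq_0 [simp]: "stack_code \<theta> = 0 \<longleftrightarrow> \<theta> = []"
  by (simp add: stack_code_def)

lemma tables_0 [simp]: "pop_table i 0 k = 0" "pop_table 0 j k = 0" "push_table 0 k = 0" "shift_table 0 k = 0"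
proof -
  have "0 \<notin> enc ` entries" using enc_pos by (metis imageE)
  then show "pop_table i 0 k = 0" "pop_table 0 j k = 0" "push_table 0 k = 0" "shift_table 0 k = 0"
    by (simp_all add: pop_table_def push_table_def shift_table_def)
qed

lemma reduce_step_code_funpow:
  "set \<theta> \<subseteq> entries \<Longrightarrow> length \<theta> \<le> k \<Longrightarrow>
     (reduce_step_code (letter_code r) ^^ k) (stack_code \<theta>) = stack_code (reduce r \<theta>)"
proof (induction r \<theta> arbitrary: k rule: reduce.induct)
  case (1 r e d \<theta>)
  have fixed: "(f ^^ k) s = s" if "f s = s" for f :: "nat \<Rightarrow> nat" and s
    using that by (induction k) auto
  show ?case
  proof (cases "eprec M (fst e) r = Gt")
    case True
    from 1 obtain k' where k: "k = Suc k'" by (cases k) auto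
    let ?d = "(fst d, mrg (snd d) (snd e))"
    have "reduce_step_code (letter_code r) (stack_code (e # d # \<theta>)) = stack_code (?d # \<theta>)"
      using 1(2) True by (simp add: reduce_step_code_def pop_table_def)
    moreover have "?d \<in> entries" using 1(2) by (auto simp: entries_def mrg_in)
    ultimately show ?thesis using 1 True unfolding k by (simp only: funpow_Suc_right o_def) simp
  next
    case False
    then have "reduce_step_code (letter_code r) (stack_code (e # d # \<theta>)) = stack_code (e # d # \<theta>)"
      using 1(2) by (simp add: reduce_step_code_def pop_table_def)
    from fixed[of "reduce_step_code (letter_code r)", OF this] False show ?thesis by simp
  qed
next
  case ("2_1" r)
  have "(reduce_step_code (letter_code r) ^^ k) 0 = 0"
    by (induction k) (auto simp: reduce_step_code_def)
  then show ?case by simp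
next
  case ("2_2" r e)
  have "(reduce_step_code (letter_code r) ^^ k) (stack_code [e]) = stack_code [e]"
    by (induction k) (auto simp: reduce_step_code_def)
  then show ?case by simp
qed

lemma reduce_code:
  "set \<theta> \<subseteq> entries \<Longrightarrow> reduce_code (letter_code r) (stack_code \<theta>) = stack_code (reduce r \<theta>)"
  unfolding reduce_code_def
  using length_le_list_encode[of "map enc \<theta>"] by (intro reduce_step_code_funpow) (auto simp: stack_code_def)

lemma advance_code:
  assumes "set \<theta> \<subseteq> entries"
  shows "advance_code (letter_code (Some b)) (stack_code \<theta>) = stack_code (advance False \<theta> b)"
proof (cases "reduce (Some b) \<theta>")
  case Nil
  then show ?thesis unfolding advance_code_def reduce_code[OF assms] by simp
next
  case (Cons e \<theta>')
  have e: "e \<in> entries" using reduce_entries[OF assms, of "Some b"] Cons by simp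
  have k: "letter_code (Some b) \<in> range (letter_code :: 'a option \<Rightarrow> nat)" by (rule rangeI)
  have tables: "push_table (enc e) (letter_code (Some b)) = (if eprec M (fst e) (Some b) = Lt then enc (Some b, psh b) else 0)"
    "shift_table (enc e) (letter_code (Some b)) = (if eprec M (fst e) (Some b) = Eq then enc (Some b, shf (snd e) b) else 0)"
    unfolding push_table_def shift_table_def inv_letter_code using e k by (simp_all del: letter_code.simps)
  show ?thesis
    unfolding advance_code_def reduce_code[OF assms] Cons stack_code_simps list_code_simps tables
    by (cases "eprec M (fst e) (Some b)") (simp_all add: advance_def Cons)
qed

lemma funpow_tail_code: "(tail_code ^^ m) (code_word w) = code_word (drop m w)"
proof (induction m)
  case (Suc m)
  then show ?case
    by (cases "drop m w") (auto simp: code_word_def drop_Suc tl_drop[symmetric])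
qed simp

lemma code_word_simps [simp]: "code_word [] = 0" "code_word (a # w) = cons_code (to_nat a) (code_word w)"
  by (simp_all add: code_word_def)

lemma code_word_eq_0 [simp]: "code_word w = 0 \<longleftrightarrow> w = []"
  by (simp add: code_word_def)

lemma run_code:
  assumes "set \<theta> \<subseteq> entries"
  shows "run_code (stack_code \<theta>) (code_word w) = stack_code (run False \<theta> w)"
proof -
  have "rec_nat (stack_code \<theta>) (\<lambda>m t. if (tail_code ^^ m) (code_word w) = 0 then t
     else advance_code (Suc (head_code ((tail_code ^^ m) (code_word w)))) t) k = stack_code (run False \<theta> (take k w))" for k
  proof (induction k)
    case (Suc k)
    show ?case
    proof (cases "k < length w")
      case False
      with Suc show ?thesis by (simp add: funpow_tail_code)
    next
      case True
      then have d: "drop k w = w ! k # drop (Suc k) w" and t: "take (Suc k) w = take k w @ [w ! k]"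
        by (simp_all add: Cons_nth_drop_Suc take_Suc_conv_app_nth)
      have "advance_code (letter_code (Some (w ! k))) (stack_code (run False \<theta> (take k w)))
         = stack_code (run False \<theta> (take (Suc k) w))"
        unfolding t by (subst advance_code) (simp_all add: run_entries assms)
      with Suc d show ?thesis by (simp add: funpow_tail_code)
    qed
  qed simp
  from this[of "code_word w"] show ?thesis
    unfolding run_code_def using length_le_list_encode[of "map to_nat w"] by (simp add: code_word_def)
qed

text \<open>The value 0 sets the empty word apart: the analysis of contexts needs a first letter of
  \<open>x\<close>.\<close>

definition first_invariant :: "nat \<Rightarrow> nat" where
  "first_invariant n = (if n = 0 then 0 else Suc (head_code n))"

definition top_invariant :: "('a option \<times> 'm) list \<Rightarrow> nat \<Rightarrow> nat" where
  "top_invariant \<theta> n = head_code (run_code (stack_code \<theta>) n)"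

text \<open>The zero tail tests for a single remaining entry, whose positive code is the value;
  otherwise it is 0. After a failed run the part below \<open>e\<close> reads as empty, a case that
  \<open>top_invariant\<close> recognises by its value 0.\<close>

definition rest_invariant :: "('a option \<times> 'm) list \<Rightarrow> 'a option \<times> 'm \<Rightarrow> 'a option \<Rightarrow> nat \<Rightarrow> nat" where
  "rest_invariant \<theta> e r n =
     (if tail_code (reduce_code (letter_code r) (cons_code (enc e) (tail_code (run_code (stack_code \<theta>) n)))) = 0
      then head_code (reduce_code (letter_code r) (cons_code (enc e) (tail_code (run_code (stack_code \<theta>) n)))) else 0)"

lemma computable_invariants:
  assumes "computable n F"
  shows "computable n (\<lambda>xs. first_invariant (F xs))" "computable n (\<lambda>xs. top_invariant \<theta> (F xs))"
    "computable n (\<lambda>xs. rest_invariant \<theta> e r (F xs))"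
  unfolding first_invariant_def top_invariant_def rest_invariant_def
  by (intro computable_if computable_Suc computable_reduce_code computable_cons_code computable_head_code
      computable_tail_code computable_run_code computable_const assms)+

lemma top_invariant:
  assumes "\<theta> \<in> starts"
  shows "top_invariant \<theta> (code_word w) = (if run False \<theta> w = [] then 0 else enc (hd (run False \<theta> w)))"
proof -
  have "set \<theta> \<subseteq> entries" using assms by (simp add: starts_def)
  then show ?thesis unfolding top_invariant_def by (cases "run False \<theta> w") (simp_all add: run_code)
qed

lemma rest_invariant:
  assumes "\<theta> \<in> starts" "e \<in> entries"
  shows "rest_invariant \<theta> e r (code_word w) = (case reduce r (e # tl (run False \<theta> w)) of [z] \<Rightarrow> enc z | _ \<Rightarrow> 0)"
proof -
  have \<theta>: "set \<theta> \<subseteq> entries" using assms by (simp add: starts_def)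
  have "cons_code (enc e) (tail_code (run_code (stack_code \<theta>) (code_word w))) = stack_code (e # tl (run False \<theta> w))"
    by (cases "run False \<theta> w") (simp_all add: run_code \<theta>)
  moreover have "set (e # tl (run False \<theta> w)) \<subseteq> entries"
    using run_entries[OF \<theta>, of False w] assms(2) by (cases "run False \<theta> w") auto
  ultimately show ?thesis unfolding rest_invariant_def
    by (cases "reduce r (e # tl (run False \<theta> w))") (auto simp: reduce_code simp del: stack_code_simps(2) split: list.split, simp_all)
qed

definition invariants :: "(nat \<Rightarrow> nat) set" where
  "invariants = insert first_invariant (top_invariant ` starts \<union>
     (\<lambda>(\<theta>, e, r). rest_invariant \<theta> e r) ` (starts \<times> entries \<times> UNIV))"

lemma finite_invariants: "finite invariants"
  unfolding invariants_def by (simp add: finite_starts finite_entries)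

lemma computable_invariant: "\<phi> \<in> invariants \<Longrightarrow> computable n F \<Longrightarrow> computable n (\<lambda>xs. \<phi> (F xs))"
  unfolding invariants_def using computable_invariants by auto

lemma finite_range_invariant:
  assumes "\<phi> \<in> invariants"
  shows "finite (range (\<lambda>w :: 'a list. \<phi> (code_word w)))"
proof -
  have fin: "finite (insert 0 (enc ` entries))" by (simp add: finite_entries)
  from assms consider "\<phi> = first_invariant" | \<theta> where "\<phi> = top_invariant \<theta>" "\<theta> \<in> starts"
    | \<theta> e r where "\<phi> = rest_invariant \<theta> e r" "\<theta> \<in> starts" "e \<in> entries"
    unfolding invariants_def by auto
  then show ?thesis
  proof cases
    case 1
    have "\<phi> (code_word w) \<in> range (letter_code :: 'a option \<Rightarrow> nat)" for w :: "'a list"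
    proof (cases w)
      case Nil
      then have "\<phi> (code_word w) = letter_code (None :: 'a option)" by (simp add: 1 first_invariant_def)
      then show ?thesis by (rule range_eqI)
    next
      case (Cons a v)
      then have "\<phi> (code_word w) = letter_code (Some a)" by (simp add: 1 first_invariant_def)
      then show ?thesis by (rule range_eqI)
    qed
    then have "range (\<lambda>w :: 'a list. \<phi> (code_word w)) \<subseteq> range (letter_code :: 'a option \<Rightarrow> nat)" by blast
    then show ?thesis by (rule finite_subset) simp
  next
    case 2
    have "\<phi> (code_word w) \<in> insert 0 (enc ` entries)" for w :: "'a list"
    proof -
      have "set (run False \<theta> w) \<subseteq> entries"
        using run_entries[of \<theta> False w] 2(2) by (simp add: starts_def)
      then show ?thesis unfolding 2(1) top_invariant[OF 2(2)] by (cases "run False \<theta> w") auto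
    qed
    then show ?thesis by (rule finite_subset[OF image_subsetI fin])
  next
    case 3
    have "\<phi> (code_word w) \<in> insert 0 (enc ` entries)" for w :: "'a list"
    proof -
      have "set (tl (run False \<theta> w)) \<subseteq> entries"
        using run_entries[of \<theta> False w] 3(2) by (cases "run False \<theta> w") (auto simp: starts_def)
      then have "set (reduce r (e # tl (run False \<theta> w))) \<subseteq> entries"
        using 3(3) by (intro reduce_entries) simp
      then show ?thesis unfolding 3(1) rest_invariant[OF 3(2,3)] by (auto split: list.split)
    qed
    then show ?thesis by (rule finite_subset[OF image_subsetI fin])
  qed
qed

lemma invariants_indist:
  assumes inv: "\<forall>\<phi>\<in>invariants. \<phi> (code_word x) = \<phi> (code_word y)" and \<theta>: "\<theta> \<in> starts"
  shows "indist (run False \<theta> x) (run False \<theta> y)"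
proof -
  have ent: "set \<theta> \<subseteq> entries" using \<theta> by (simp add: starts_def)
  have "top_invariant \<theta> (code_word x) = top_invariant \<theta> (code_word y)"
    using inv \<theta> unfolding invariants_def by blast
  then have top: "run False \<theta> x = [] \<longleftrightarrow> run False \<theta> y = []"
    "run False \<theta> x \<noteq> [] \<Longrightarrow> enc (hd (run False \<theta> x)) = enc (hd (run False \<theta> y))"
    unfolding top_invariant[OF \<theta>] by (auto split: if_splits)
  have hd: "hd (run False \<theta> x) = hd (run False \<theta> y)" if "run False \<theta> x \<noteq> []"
    using inj_onD[OF inj_enc top(2)[OF that]] that top(1) run_entries[OF ent, of False x] run_entries[OF ent, of False y]
    by (meson hd_in_set subsetD)
  have "reduce r (e # tl (run False \<theta> x)) = [z] \<longleftrightarrow> reduce r (e # tl (run False \<theta> y)) = [z]" if e: "e \<in> entries" for e r z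
  proof -
    have E: "set (reduce r (e # tl (run False \<theta> w))) \<subseteq> entries" for w
    proof (rule reduce_entries)
      show "set (e # tl (run False \<theta> w)) \<subseteq> entries"
        using run_entries[OF ent, of False w] e by (cases "run False \<theta> w") auto
    qed
    have "rest_invariant \<theta> e r \<in> invariants"
      unfolding invariants_def using \<theta> e by (intro insertI2 UnI2 image_eqI[of _ _ "(\<theta>, e, r)"]) auto
    then have "rest_invariant \<theta> e r (code_word x) = rest_invariant \<theta> e r (code_word y)"
      using inv by blast
    then have eq: "(case reduce r (e # tl (run False \<theta> x)) of [z] \<Rightarrow> enc z | _ \<Rightarrow> 0)
       = (case reduce r (e # tl (run False \<theta> y)) of [z] \<Rightarrow> enc z | _ \<Rightarrow> 0)"
      unfolding rest_invariant[OF \<theta> e] .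
    \<comment> \<open>Codes of entries are positive and injective on \<open>entries\<close>, so the
      value reveals whether the stack is a single entry, and which one.\<close>
    have "s' = [z]" if "s = [z]" "set s \<subseteq> entries" "set s' \<subseteq> entries"
      "(case s of [z] \<Rightarrow> enc z | _ \<Rightarrow> 0) = (case s' of [z] \<Rightarrow> enc z | _ \<Rightarrow> 0)" for s s'
      using that inj_enc by (auto split: list.splits dest: inj_onD)
    from this[OF _ E E eq] this[OF _ E E eq[symmetric]] show ?thesis by blast
  qed
  with top(1) hd show ?thesis unfolding indist_def by blast
qed

lemma invariants_first:
  assumes inv: "\<forall>\<phi>\<in>invariants. \<phi> (code_word x) = \<phi> (code_word (y :: 'a list))"
  shows "first x = first y"
proof -
  have "first_invariant (code_word x) = first_invariant (code_word y)"
    using inv unfolding invariants_def by blast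
  then show ?thesis
    by (cases x; cases y) (auto simp: first_invariant_def first_def)
qed

theorem language_abstraction_syntactic_congruence:
  assumes "\<rho>\<^sub>0 \<in> C" and "\<And>w. w \<in> L \<longleftrightarrow> P (reduce None (run False [(None, \<rho>\<^sub>0)] w))"
  shows "language_abstraction M L (syntactic_congruence M L)"
proof -
  have *: "syntactic_congruence M L x y" if inv: "\<forall>\<phi>\<in>invariants. \<phi> (code_word x) = \<phi> (code_word y)" for x y
  proof (cases "x = []")
    case True
    then have "y = []" using invariants_first[OF inv] by (metis first_eq_None)
    with True show ?thesis by (simp add: syntactic_congruence_refl)
  next
    case False
    moreover have "y \<noteq> []" using invariants_first[OF inv] False by (metis first_eq_None)
    ultimately show ?thesis
      using invariants_indist[OF inv] invariants_first[OF inv] assms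
      by (intro indist_syntactic_congruence[where P = P and \<rho>\<^sub>0 = \<rho>\<^sub>0]) auto
  qed
  note fin = equiv_finite_invariants[OF finite_invariants _ finite_range_invariant, of "syntactic_congruence M L"]
  have comp: "computable 2 (\<lambda>xs. \<phi> (xs ! 0)) \<and> computable 2 (\<lambda>xs. \<phi> (xs ! 1))" if "\<phi> \<in> invariants" for \<phi>
    using computable_invariant[OF that] computable_nth[of 0 2] computable_nth[of 1 2] by simp
  have equiv: "reflp (syntactic_congruence M L)" "symp (syntactic_congruence M L)" "transp (syntactic_congruence M L)"
    by (auto intro!: reflpI sympI transpI intro: syntactic_congruence_refl syntactic_congruence_sym syntactic_congruence_trans)
  show ?thesis
    unfolding language_abstraction_def
    using fin[OF comp _ * equiv] chain_monotonic_syntactic_congruence saturates_syntactic_congruence by blast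
qed

end

theorem proposition32:
  fixes M :: "'a::finite opm" and L :: "'a list set"
  assumes "op_language M L"
  shows "language_abstraction M L (syntactic_congruence M L)"
proof -
  from assms obtain A :: "('a, nat) opa" where A: "opa A" "opa_language M A = L"
    unfolding op_language_def by blast
  interpret automaton M A by unfold_locales (rule A)
  show ?thesis
  proof (rule language_abstraction_syntactic_congruence)
    show "Id_on (states A) \<in> Pow (states A \<times> states A)" by auto
    show "w \<in> L \<longleftrightarrow> snd (hd (reduce None (run False [(None, Id_on (states A))] w))) \<inter> initial A \<times> accepting A \<noteq> {}" for w
      using opa_language_iff A(2) by simp
  qed
qed

end
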